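(* Let $K\hookrightarrow K(x)$ be a simple transcendental field extension, $\mu'$ a valuation of $K(x)$ with $\mu'(x)>0$, and $\mu=\mu'|_K$. Assume $\mu$ has rank $1$ and that its residue field $k_\mu$ has characteristic $0$. Then there exists a $1$-complete set of key polynomials $\{Q_i\}_{i\in\Lambda}$ for $\mu'$ such that $\Lambda$ is either a finite set or $\mathbb N^*$. In particular, there are no limit key polynomials for rank $1$ valuations with residue field of characteristic $0$.
   Context: Let $G$ be the value group of $\mu'$ and $G_1$ that of $\mu$. A $1$-complete set of key polynomials for $\mu'$ is a well-ordered collection $\{Q_i\}_{i\in\Lambda}\subset K[x]$, obtained by the recursive construction below, such that for every $\beta\in G_1$ the additive group $\{f\in K[x]:\mu'(f)\ge\beta\}\cup\{0\}$ is generated by products of the form $a\prod_{j=1}^sQ_{i_j}^{\gamma_j}$, $a\in K$, $\gamma_j\in\mathbb N$, with $\sum_{j=1}^s\gamma_j\mu'(Q_{i_j})+\mu(a)\ge\beta$. Recursive construction: $Q_1=x$; put $\beta_i=\mu'(Q_i)$. For $f=\sum_jc_jQ_i^j\in K[x]$ with $\deg_xc_j<\deg_xQ_i$, the $i$-truncation of $\mu'$ is $\mu'_i(f)=\min_j\{j\beta_i+\mu'(c_j)\}$; one has $\mu'_i(f)\le\mu'(f)$. Then $Q_{i+1}$ is a monic polynomial of least degree among the monic $Q\in K[x]$ with $\mu'_i(Q)<\mu'(Q)$, and its expansion $Q_{i+1}=Q_i^{\alpha_{i+1}}+\sum_{j<\alpha_{i+1}}c_jQ_i^j$ ($\deg_xc_j<\deg_xQ_i$)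 is homogeneous: all nonzero terms have value $\alpha_{i+1}\beta_i$. (When $\alpha_{i+1}=1$ this reads $Q_{i+1}=Q_i+z_i$ with $\mu'(z_i)=\beta_i$.) A key polynomial whose index in $\Lambda$ is a limit ordinal, i.e. one introduced after infinitely many key polynomials without an immediate predecessor, is called a limit key polynomial; when $\Lambda=\{1,\dots,N\}$ or $\Lambda=\mathbb N^*$ there is none. *)

theory Defs
  imports
    "HOL-Algebra.QuotRing"
    "HOL-Computational_Algebra.Polynomial_Factorial"
    "HOL-Computational_Algebra.Group_Closure"
begin

section \<open>Valuations\<close>

text \<open>A (Krull) valuation of a field \<open>L\<close> is a map from the nonzero elements of \<open>L\<close> to an ordered
  abelian group. The value at \<open>0\<close> is unspecified and is never used below.\<close>

definition is_valuation :: "('a::field \<Rightarrow> 'g::linordered_ab_group_add) \<Rightarrow> bool" where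
  "is_valuation v \<longleftrightarrow>
     (\<forall>a b. a \<noteq> 0 \<longrightarrow> b \<noteq> 0 \<longrightarrow> v (a * b) = v a + v b) \<and>
     (\<forall>a b. a \<noteq> 0 \<longrightarrow> b \<noteq> 0 \<longrightarrow> a + b \<noteq> 0 \<longrightarrow> min (v a) (v b) \<le> v (a + b))"

definition value_group :: "('a::field \<Rightarrow> 'g::linordered_ab_group_add) \<Rightarrow> 'g set" where
  "value_group v = v ` {a. a \<noteq> 0}"

definition isolated_subgroup :: "'g::linordered_ab_group_add set \<Rightarrow> 'g set \<Rightarrow> bool" where
  "isolated_subgroup H G \<longleftrightarrow>
     H \<subseteq> G \<and> 0 \<in> H \<and> (\<forall>a\<in>H. \<forall>b\<in>H. a - b \<in> H) \<and>
     (\<forall>a\<in>H. \<forall>b\<in>G. 0 \<le> b \<longrightarrow> b \<le> a \<longrightarrow> b \<in> H)"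

definition has_rank :: "('a::field \<Rightarrow> 'g::linordered_ab_group_add) \<Rightarrow> nat \<Rightarrow> bool" where
  "has_rank v n \<longleftrightarrow>
     finite {H. isolated_subgroup H (value_group v) \<and> H \<noteq> value_group v} \<and>
     card {H. isolated_subgroup H (value_group v) \<and> H \<noteq> value_group v} = n"

definition valuation_ring :: "('a::field \<Rightarrow> 'g::linordered_ab_group_add) \<Rightarrow> 'a ring" where
  "valuation_ring v =
     \<lparr>carrier = {a. a = 0 \<or> 0 \<le> v a}, monoid.mult = (*), one = 1, zero = 0, add = (+)\<rparr>"

definition valuation_ideal :: "('a::field \<Rightarrow> 'g::linordered_ab_group_add) \<Rightarrow> 'a set" where
  "valuation_ideal v = {a. a = 0 \<or> 0 < v a}"

definition residue_field :: "('a::field \<Rightarrow> 'g::linordered_ab_group_add) \<Rightarrow> 'a set ring" where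
  "residue_field v = valuation_ring v Quot valuation_ideal v"

definition has_char_0 :: "('r, 'm) ring_scheme \<Rightarrow> bool" where
  "has_char_0 R \<longleftrightarrow> (\<forall>n::nat. n > 0 \<longrightarrow> add_pow R n \<one>\<^bsub>R\<^esub> \<noteq> \<zero>\<^bsub>R\<^esub>)"


section \<open>The extension \<open>K \<hookrightarrow> K(x)\<close>\<close>

text \<open>\<open>K(x)\<close> is the fraction field of \<open>K[x]\<close>; a valuation \<open>v\<close> of \<open>K(x)\<close> is evaluated on \<open>K[x]\<close>
  by \<open>poly_val v\<close> and on \<open>K\<close> by \<open>const_val v\<close>.\<close>

definition poly_val :: "('k::field poly fract \<Rightarrow> 'g) \<Rightarrow> 'k poly \<Rightarrow> 'g" where
  "poly_val v f = v (to_fract f)"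

definition const_val :: "('k::field poly fract \<Rightarrow> 'g) \<Rightarrow> 'k \<Rightarrow> 'g" where
  "const_val v a = v (to_fract [:a:])"

abbreviation var_x :: "'k::field poly" where
  "var_x \<equiv> [:0, 1:]"

definition nat_scale :: "nat \<Rightarrow> 'g::comm_monoid_add \<Rightarrow> 'g" where
  "nat_scale n b = (\<Sum>_<n. b)"


section \<open>Truncations\<close>

text \<open>The \<open>j\<close>-th coefficient of the \<open>Q\<close>-adic expansion of \<open>f\<close>, for nonconstant \<open>Q\<close>; the lemmas below
  show that it is the unique expansion with coefficients of degree less than that of \<open>Q\<close>.\<close>

definition adic_coeff :: "'k::field poly \<Rightarrow> 'k poly \<Rightarrow> nat \<Rightarrow> 'k poly" where
  "adic_coeff Q f j = (f div Q ^ j) mod Q"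

lemma degree_adic_coeff:
  assumes "degree Q > 0"
  shows "degree (adic_coeff Q f j) < degree Q"
  using assms by (metis adic_coeff_def degree_0 degree_mod_less less_not_refl)

lemma adic_expansion_partial:
  "f = (\<Sum>j<n. adic_coeff Q f j * Q ^ j) + (f div Q ^ n) * Q ^ n"
proof (induction n)
  case (Suc n)
  have "f div Q ^ n = (f div Q ^ n div Q) * Q + adic_coeff Q f n"
    by (simp add: adic_coeff_def)
  also have "f div Q ^ n div Q = f div Q ^ Suc n"
    by (metis poly_div_mult_right power_Suc2)
  finally have "(f div Q ^ n) * Q ^ n
      = (f div Q ^ Suc n) * Q ^ Suc n + adic_coeff Q f n * Q ^ n"
    by (metis distrib_right mult.assoc power_Suc)
  with Suc show ?case
    by (simp add: algebra_simps)
qed simp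

lemma adic_expansion:
  assumes "degree Q > 0"
  shows "f = (\<Sum>j\<le>degree f. adic_coeff Q f j * Q ^ j)"
    and "j > degree f \<Longrightarrow> adic_coeff Q f j = 0"
proof -
  have *: "f div Q ^ n = 0" if "n > degree f" for n
  proof -
    have "degree (Q ^ n) = n * degree Q"
      using assms by (subst degree_power_eq) auto
    also have "\<dots> \<ge> n" using assms by simp
    finally show ?thesis using that by (intro div_poly_less) simp
  qed
  show "f = (\<Sum>j\<le>degree f. adic_coeff Q f j * Q ^ j)"
    using adic_expansion_partial [of f Q "Suc (degree f)"] * [of "Suc (degree f)"]
    by (simp add: lessThan_Suc_atMost)
  show "adic_coeff Q f j = 0" if "j > degree f"
    using * [OF that] by (simp add: adic_coeff_def)
qed

lemma adic_coeff_unique: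
  assumes "degree Q > 0" and "\<And>j. degree (c j) < degree Q" and "j < n"
  shows "adic_coeff Q (\<Sum>j<n. c j * Q ^ j) j = c j"
  using assms(2,3)
proof (induction n arbitrary: c j)
  case (Suc n)
  have Q: "Q \<noteq> 0" using assms(1) by auto
  define r where "r = (\<Sum>j<n. c (Suc j) * Q ^ j)"
  have eq: "(\<Sum>j<Suc n. c j * Q ^ j) = c 0 + r * Q"
    unfolding sum.lessThan_Suc_shift r_def by (simp add: sum_distrib_left sum_distrib_right algebra_simps)
  have d: "(c 0 + r * Q) div Q = r"
    using Suc.prems(1) [of 0] Q by (simp add: div_poly_less)
  have m: "(c 0 + r * Q) mod Q = c 0"
    using Suc.prems(1) [of 0] by (simp add: mod_poly_less)
  show ?case
  proof (cases j)
    case 0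
    then show ?thesis using m eq by (simp add: adic_coeff_def)
  next
    case (Suc i)
    have "(c 0 + r * Q) div Q ^ Suc i = r div Q ^ i"
      by (metis d poly_div_mult_right power_Suc)
    then show ?thesis
      using Suc.IH [of "\<lambda>j. c (Suc j)" i] Suc.prems Suc eq
      by (simp add: adic_coeff_def r_def)
  qed
qed simp

text \<open>The truncation of \<open>v\<close> defined by \<open>Q\<close>, for \<open>Q\<close> nonconstant and \<open>f \<noteq> 0\<close>. Vanishing coefficients
  have value \<open>\<infinity>\<close> and do not contribute to the minimum.\<close>

definition truncation ::
    "('k::field poly fract \<Rightarrow> 'g::linordered_ab_group_add) \<Rightarrow> 'k poly \<Rightarrow> 'k poly \<Rightarrow> 'g" where
  "truncation v Q f =
     Min {nat_scale j (poly_val v Q) + poly_val v (adic_coeff Q f j) | j. adic_coeff Q f j \<noteq> 0}"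


section \<open>Key polynomials\<close>

text \<open>Index sets are subsets of a well-ordered type.\<close>

definition is_first :: "'i::wellorder set \<Rightarrow> 'i \<Rightarrow> bool" where
  "is_first \<Lambda> i \<longleftrightarrow> i \<in> \<Lambda> \<and> (\<forall>k\<in>\<Lambda>. i \<le> k)"

definition is_next :: "'i::wellorder set \<Rightarrow> 'i \<Rightarrow> 'i \<Rightarrow> bool" where
  "is_next \<Lambda> i j \<longleftrightarrow> i \<in> \<Lambda> \<and> j \<in> \<Lambda> \<and> i < j \<and> \<not> (\<exists>k\<in>\<Lambda>. i < k \<and> k < j)"

definition is_limit :: "'i::wellorder set \<Rightarrow> 'i \<Rightarrow> bool" where
  "is_limit \<Lambda> j \<longleftrightarrow> j \<in> \<Lambda> \<and> \<not> is_first \<Lambda> j \<and> \<not> (\<exists>i. is_next \<Lambda> i j)"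

definition least_degree_monic :: "('k::field poly \<Rightarrow> bool) \<Rightarrow> 'k poly \<Rightarrow> bool" where
  "least_degree_monic P Q \<longleftrightarrow>
     lead_coeff Q = 1 \<and> P Q \<and> (\<forall>R. lead_coeff R = 1 \<longrightarrow> P R \<longrightarrow> degree Q \<le> degree R)"

definition homogeneous_expansion ::
    "('k::field poly fract \<Rightarrow> 'g::linordered_ab_group_add) \<Rightarrow> 'k poly \<Rightarrow> 'k poly \<Rightarrow> bool" where
  "homogeneous_expansion v Q R \<longleftrightarrow>
     (\<exists>\<alpha>\<ge>1. \<exists>c. R = Q ^ \<alpha> + (\<Sum>j<\<alpha>. c j * Q ^ j) \<and>
        (\<forall>j<\<alpha>. degree (c j) < degree Q \<and>
           (c j \<noteq> 0 \<longrightarrow>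
             nat_scale j (poly_val v Q) + poly_val v (c j) = nat_scale \<alpha> (poly_val v Q))))"

text \<open>The last conjunct is the usual recursion at limit indices. It is vacuous when every index has
  only finitely many predecessors, in particular for index sets of natural numbers.\<close>

definition key_polynomials ::
    "('k::field poly fract \<Rightarrow> 'g::linordered_ab_group_add) \<Rightarrow> 'i::wellorder set \<Rightarrow>
     ('i \<Rightarrow> 'k poly) \<Rightarrow> bool" where
  "key_polynomials v \<Lambda> Q \<longleftrightarrow>
     \<Lambda> \<noteq> {} \<and>
     (\<forall>i. is_first \<Lambda> i \<longrightarrow> Q i = var_x) \<and>
     (\<forall>i j. is_next \<Lambda> i j \<longrightarrow>
        least_degree_monic (\<lambda>R. truncation v (Q i) R < poly_val v R) (Q j) \<and>
        homogeneous_expansion v (Q i) (Q j)) \<and>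
     (\<forall>j. is_limit \<Lambda> j \<longrightarrow>
        least_degree_monic (\<lambda>R. \<forall>i\<in>\<Lambda>. i < j \<longrightarrow> truncation v (Q i) R < poly_val v R) (Q j))"

definition key_products ::
    "('k::field poly fract \<Rightarrow> 'g::linordered_ab_group_add) \<Rightarrow> 'i set \<Rightarrow> ('i \<Rightarrow> 'k poly) \<Rightarrow> 'g \<Rightarrow>
     'k poly set" where
  "key_products v \<Lambda> Q \<beta> =
     {[:a:] * (\<Prod>i\<in>I. Q i ^ \<gamma> i) | a I \<gamma>.
        a \<noteq> 0 \<and> finite I \<and> I \<subseteq> \<Lambda> \<and>
        (\<Sum>i\<in>I. nat_scale (\<gamma> i) (poly_val v (Q i))) + const_val v a \<ge> \<beta>}"

definition one_complete_key_polynomials ::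
    "('k::field poly fract \<Rightarrow> 'g::linordered_ab_group_add) \<Rightarrow> 'i::wellorder set \<Rightarrow>
     ('i \<Rightarrow> 'k poly) \<Rightarrow> bool" where
  "one_complete_key_polynomials v \<Lambda> Q \<longleftrightarrow>
     key_polynomials v \<Lambda> Q \<and>
     (\<forall>\<beta>\<in>value_group (const_val v).
        group_closure (key_products v \<Lambda> Q \<beta>) = {f. f \<noteq> 0 \<and> poly_val v f \<ge> \<beta>} \<union> {0})"

end

theory Submission
  imports Defs "HOL-Library.Nat_Bijection"
begin

text \<open>
  A key polynomial \<open>Q\<close> is characterised here by the way it multiplies: if \<open>a\<close>, \<open>c\<close> have smaller
  degree than \<open>Q\<close> and \<open>a c = h Q + r\<close>, then \<open>r\<close> has the value of \<open>a c\<close>, and \<open>h Q\<close> has larger value, by a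
  margin \<open>v(Q) - \<tau>\<close> that does not depend on \<open>a\<close> and \<open>c\<close>. This property makes the truncation at \<open>Q\<close> a
  valuation (\<open>truncation_mult\<close>), and it is inherited by every monic polynomial of least degree whose
  value exceeds its truncation (\<open>key_step\<close>). Inverting leading coefficients modulo \<open>Q\<close> turns such a
  polynomial into a homogeneous one of no larger degree (\<open>homogeneous_exists\<close>). So the recursion can
  always be continued until some truncation equals \<open>v\<close>, and the only question is how to choose the
  polynomials so that no limit index is needed.

  If the next polynomial has the same degree \<open>d\<close> as \<open>Q\<close>, there are many candidates, namely all monic
  polynomials of degree \<open>d\<close> and larger value. If the values of the monic polynomials of degree \<open>d\<close> have
  a maximum, choose a polynomial attaining it: then the degree grows at the following step. If they have
  none, they all lie in the divisible hull of the value group of \<open>K\<close>, which is archimedean since the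
  rank is one; hence countably many of them are cofinal, and the rest of the sequence is chosen to pass
  all of these.

  It remains to see that every \<open>f\<close> of value at least \<open>\<beta>\<close>, with \<open>\<beta>\<close> in the value group of \<open>K\<close>, has
  truncated value at least \<open>\<beta>\<close> at some member of the sequence, for then successive expansions express it
  by products of value at least \<open>\<beta>\<close> (\<open>generated_by_products\<close>). This is clear if the degrees are unbounded
  or the sequence stops. On an infinite plateau of degree \<open>d\<close> it is \<open>plateau_truncation\<close>. Let
  \<open>c\<^sub>\<delta> Q\<^sup>\<delta>\<close> be the last dominant term of \<open>f\<close>, with \<open>\<delta>\<close> minimal over the plateau. If \<open>\<delta> = 0\<close>, the truncation
  is exact. Otherwise no further improvement of \<open>Q\<close> changes \<open>\<delta>\<close>. As \<open>\<delta>\<close> has value \<open>0\<close> in residue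
  characteristic \<open>0\<close>, the Newton (or Tschirnhausen) substitution \<open>Q + c\<^bsub>\<delta>-1\<^esub> / (\<delta> c\<^sub>\<delta>)\<close>, with the
  quotient taken modulo \<open>Q\<close>, is better than \<open>Q\<close> by an amount bounded below independently of \<open>Q\<close>
  (\<open>newton_step\<close>). As the rank is one, finitely many such steps bring the truncated value of \<open>f\<close> up
  to \<open>\<beta>\<close>.
\<close>

section \<open>Natural multiples in an ordered group\<close>

notation nat_scale (infixr "\<cdot>" 75)

lemma nat_scale_0 [simp]: "0 \<cdot> b = 0"
  by (simp add: nat_scale_def)

lemma nat_scale_Suc [simp]: "Suc n \<cdot> b = b + n \<cdot> b"
  by (simp add: nat_scale_def ac_simps)

lemma nat_scale_zero [simp]: "n \<cdot> 0 = 0"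
  by (induction n) auto

lemma nat_scale_add: "(m + n) \<cdot> b = m \<cdot> b + n \<cdot> b"
  by (induction m) (auto simp: ac_simps)

lemma nat_scale_plus: "n \<cdot> (a + b) = n \<cdot> a + n \<cdot> b"
  by (induction n) (auto simp: ac_simps)

lemma nat_scale_mult: "(m * n) \<cdot> b = m \<cdot> n \<cdot> b"
  by (induction m) (auto simp: nat_scale_add)

lemma nat_scale_diff: "n \<cdot> (a - b) = n \<cdot> a - n \<cdot> (b :: 'g::ab_group_add)"
  by (induction n) auto

lemma nat_scale_mono: "a \<le> b \<Longrightarrow> n \<cdot> a \<le> n \<cdot> (b :: 'g::linordered_ab_group_add)"
  by (induction n) (auto intro: add_mono)

lemma nat_scale_strict_mono:
  "n > 0 \<Longrightarrow> a < b \<Longrightarrow> n \<cdot> a < n \<cdot> (b :: 'g::linordered_ab_group_add)"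
  by (induction n rule: nat_induct_non_zero) (auto intro: add_strict_mono)

lemma nat_scale_nonneg: "0 \<le> b \<Longrightarrow> 0 \<le> n \<cdot> (b :: 'g::linordered_ab_group_add)"
  using nat_scale_mono [of 0 b n] by simp

lemma nat_scale_mono_left:
  assumes "m \<le> n" "0 \<le> b"
  shows "m \<cdot> b \<le> n \<cdot> (b :: 'g::linordered_ab_group_add)"
proof -
  from assms(1) obtain k where "n = m + k" using le_iff_add by blast
  then show ?thesis using nat_scale_nonneg [OF assms(2)] by (simp add: nat_scale_add)
qed

section \<open>Expansions\<close>

lemma adic_coeff_zero [simp]: "adic_coeff Q 0 k = 0"
  by (simp add: adic_coeff_def)

lemma adic_coeff_add: "adic_coeff Q (f + g) k = adic_coeff Q f k + adic_coeff Q g k"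
  by (simp add: adic_coeff_def poly_div_add_left poly_mod_add_left)

lemma adic_coeff_diff: "adic_coeff Q (f - g) k = adic_coeff Q f k - adic_coeff Q g k"
  by (simp add: adic_coeff_def poly_div_diff_left poly_mod_diff_left)

lemma adic_coeff_term:
  assumes "degree a < degree Q"
  shows "adic_coeff Q (a * Q ^ i) k = (if k = i then a else 0)"
proof -
  let ?c = "\<lambda>j. if j = i then a else 0"
  have "a * Q ^ i = (\<Sum>j<Suc (max i k). ?c j * Q ^ j)"
  proof -
    have "(\<Sum>j<Suc (max i k). ?c j * Q ^ j) = (\<Sum>j<Suc (max i k). if j = i then a * Q ^ i else 0)"
      by (rule sum.cong) auto
    then show ?thesis by (simp add: sum.delta)
  qed
  then show ?thesis
    using adic_coeff_unique [of Q ?c k "Suc (max i k)"] assms by auto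
qed

lemma adic_coeff_small:
  assumes "degree a < degree Q"
  shows "adic_coeff Q a k = (if k = 0 then a else 0)"
  using adic_coeff_term [OF assms, of 0 k] by simp

lemma adic_coeff_nonzero_degree:
  assumes "adic_coeff Q f k \<noteq> 0" "degree Q > 0"
  shows "k * degree Q \<le> degree f"
proof (rule ccontr)
  assume "\<not> ?thesis"
  moreover have "degree (Q ^ k) = k * degree Q"
    using assms(2) by (subst degree_power_eq) auto
  ultimately have "f div Q ^ k = 0" by (intro div_poly_less) simp
  with assms(1) show False by (simp add: adic_coeff_def)
qed

lemma adic_expansion_lessThan:
  assumes "degree Q > 0" "degree f < n"
  shows "f = (\<Sum>j<n. adic_coeff Q f j * Q ^ j)"
proof -
  have "(\<Sum>j\<le>degree f. adic_coeff Q f j * Q ^ j) = (\<Sum>j<n. adic_coeff Q f j * Q ^ j)"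
    using assms adic_expansion(2) [OF assms(1)] by (intro sum.mono_neutral_left) auto
  then show ?thesis using adic_expansion(1) [OF assms(1), of f] by simp
qed

lemma adic_coeff_nonzero_exists:
  assumes "degree Q > 0" "f \<noteq> 0"
  shows "\<exists>k. adic_coeff Q f k \<noteq> 0"
proof (rule ccontr)
  assume "\<not> ?thesis"
  then have "(\<Sum>j\<le>degree f. adic_coeff Q f j * Q ^ j) = 0" by simp
  with adic_expansion(1) [OF assms(1), of f] assms(2) show False by simp
qed

lemma finite_adic_support:
  assumes "degree Q > 0"
  shows "finite {k. adic_coeff Q f k \<noteq> 0}"
proof (rule finite_subset)
  show "{k. adic_coeff Q f k \<noteq> 0} \<subseteq> {..degree f}"
    using adic_expansion(2) [OF assms, of f] by (auto simp: not_less [symmetric])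
qed simp

section \<open>Valuations of polynomials\<close>

locale poly_valuation =
  fixes v :: "'k::field poly fract \<Rightarrow> 'g::linordered_ab_group_add"
  assumes valuation: "is_valuation v"
begin

abbreviation u :: "'k poly \<Rightarrow> 'g" where "u \<equiv> poly_val v"

lemma val_mult: "f \<noteq> 0 \<Longrightarrow> g \<noteq> 0 \<Longrightarrow> u (f * g) = u f + u g"
  using valuation by (auto simp: is_valuation_def poly_val_def)

lemma val_add: "f \<noteq> 0 \<Longrightarrow> g \<noteq> 0 \<Longrightarrow> f + g \<noteq> 0 \<Longrightarrow> min (u f) (u g) \<le> u (f + g)"
  using valuation unfolding is_valuation_def poly_val_def
  by (metis to_fract_add to_fract_eq_0_iff)

lemma val_1 [simp]: "u 1 = 0"
  using val_mult [of 1 1] by simp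

lemma val_minus [simp]: "u (- f) = u f"
proof (cases "f = 0")
  case False
  have "u (- 1) + u (- 1) = 0" using val_mult [of "- 1" "- 1"] by simp
  then have "u (- 1) = 0" by (metis add_neg_neg add_pos_pos less_irrefl linorder_neqE)
  then show ?thesis using val_mult [of "- 1" f] False by simp
qed simp

lemma val_power: "f \<noteq> 0 \<Longrightarrow> u (f ^ n) = n \<cdot> u f"
  by (induction n) (auto simp: val_mult)

text \<open>The value of \<open>0\<close> is to be read as \<open>\<infinity>\<close>; the two predicates below build this convention in.\<close>

definition vge :: "'g \<Rightarrow> 'k poly \<Rightarrow> bool" where
  "vge \<gamma> f \<longleftrightarrow> f = 0 \<or> \<gamma> \<le> u f"

definition vgt :: "'g \<Rightarrow> 'k poly \<Rightarrow> bool" where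
  "vgt \<gamma> f \<longleftrightarrow> f = 0 \<or> \<gamma> < u f"

lemma vge_0 [simp]: "vge \<gamma> 0" by (simp add: vge_def)
lemma vgt_0 [simp]: "vgt \<gamma> 0" by (simp add: vgt_def)
lemma vge_self [simp]: "vge (u f) f" by (simp add: vge_def)
lemma vge_minus [simp]: "vge \<gamma> (- f) = vge \<gamma> f" by (simp add: vge_def)
lemma vgt_minus [simp]: "vgt \<gamma> (- f) = vgt \<gamma> f" by (simp add: vgt_def)

lemma vge_add: "vge \<gamma> f \<Longrightarrow> vge \<gamma> g \<Longrightarrow> vge \<gamma> (f + g)"
  using val_add [of f g] unfolding vge_def
  by (metis add.left_neutral add.right_neutral min.bounded_iff order_trans)

lemma vgt_add: "vgt \<gamma> f \<Longrightarrow> vgt \<gamma> g \<Longrightarrow> vgt \<gamma> (f + g)"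
  using val_add [of f g] unfolding vgt_def
  by (metis add.left_neutral add.right_neutral min_less_iff_conj order_less_le_trans)

lemma vge_diff: "vge \<gamma> f \<Longrightarrow> vge \<gamma> g \<Longrightarrow> vge \<gamma> (f - g)"
  using vge_add [of \<gamma> f "- g"] by simp

lemma vgt_diff: "vgt \<gamma> f \<Longrightarrow> vgt \<gamma> g \<Longrightarrow> vgt \<gamma> (f - g)"
  using vgt_add [of \<gamma> f "- g"] by simp

lemma vge_sum: "(\<And>i. i \<in> A \<Longrightarrow> vge \<gamma> (f i)) \<Longrightarrow> vge \<gamma> (\<Sum>i\<in>A. f i)"
  by (induction A rule: infinite_finite_induct) (auto intro: vge_add)

lemma vgt_sum: "(\<And>i. i \<in> A \<Longrightarrow> vgt \<gamma> (f i)) \<Longrightarrow> vgt \<gamma> (\<Sum>i\<in>A. f i)"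
  by (induction A rule: infinite_finite_induct) (auto intro: vgt_add)

lemma vge_mult: "vge \<gamma> f \<Longrightarrow> vge \<gamma>' g \<Longrightarrow> vge (\<gamma> + \<gamma>') (f * g)"
  unfolding vge_def using val_mult [of f g] by (cases "f = 0"; cases "g = 0"; auto intro: add_mono)

lemma vge_mono: "vge \<gamma> f \<Longrightarrow> \<gamma>' \<le> \<gamma> \<Longrightarrow> vge \<gamma>' f"
  by (auto simp: vge_def)

lemma vgt_imp_vge: "vgt \<gamma> f \<Longrightarrow> vge \<gamma> f"
  by (auto simp: vge_def vgt_def)

lemma val_close:
  assumes "f \<noteq> 0" "vgt (u f) (f - g)"
  shows "g \<noteq> 0" "u g = u f"
proof -
  show g: "g \<noteq> 0" using assms by (auto simp: vgt_def)
  have "vge (u f) g" using vge_diff [OF vge_self vgt_imp_vge [OF assms(2)]] by simp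
  then have 1: "u f \<le> u g" using g by (simp add: vge_def)
  show "u g = u f"
  proof (rule ccontr)
    assume "u g \<noteq> u f"
    with 1 have "vgt (u f) g" by (auto simp: vgt_def)
    from vgt_add [OF assms(2) this] show False using assms(1) by (simp add: vgt_def)
  qed
qed

section \<open>The filtration by truncated values\<close>

text \<open>Every term of the \<open>Q\<close>-expansion of \<open>f\<close>, with weight \<open>b\<close> for \<open>Q\<close>, has value at least \<open>\<gamma>\<close>,
  and those of index at least \<open>m\<close> exceed \<open>\<gamma>\<close> by \<open>e\<close>.  Modulo terms of value at least \<open>\<gamma> + e\<close>
  the polynomial \<open>f\<close> thus looks like a polynomial of degree less than \<open>m\<close> in \<open>Q\<close>. The weight \<open>b\<close> is
  the value of \<open>Q\<close> when truncations are studied; expansions at two polynomials of the same degree are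
  compared by giving the better one the smaller value of the other as its weight.\<close>

definition filt :: "'k poly \<Rightarrow> 'g \<Rightarrow> 'g \<Rightarrow> nat \<Rightarrow> 'g \<Rightarrow> 'k poly \<Rightarrow> bool" where
  "filt Q b e m \<gamma> f \<longleftrightarrow>
     (\<forall>k. vge (\<gamma> - k \<cdot> b) (adic_coeff Q f k) \<and> (m \<le> k \<longrightarrow> vge (\<gamma> + e - k \<cdot> b) (adic_coeff Q f k)))"

lemma filt_0 [simp]: "filt Q b e m \<gamma> 0" by (simp add: filt_def)

lemma filt_add: "filt Q b e m \<gamma> f \<Longrightarrow> filt Q b e m \<gamma> g \<Longrightarrow> filt Q b e m \<gamma> (f + g)"
  by (simp add: filt_def adic_coeff_add vge_add)

lemma filt_diff: "filt Q b e m \<gamma> f \<Longrightarrow> filt Q b e m \<gamma> g \<Longrightarrow> filt Q b e m \<gamma> (f - g)"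
  by (simp add: filt_def adic_coeff_diff vge_diff)

lemma filt_sum: "(\<And>i. i \<in> A \<Longrightarrow> filt Q b e m \<gamma> (f i)) \<Longrightarrow> filt Q b e m \<gamma> (\<Sum>i\<in>A. f i)"
  by (induction A rule: infinite_finite_induct) (auto intro: filt_add)

lemma filt_mono: "filt Q b e m \<gamma> f \<Longrightarrow> m \<le> m' \<Longrightarrow> filt Q b e m' \<gamma> f"
  by (auto simp: filt_def)

lemma filt_shift: "filt Q b e m (\<gamma> + e) f \<Longrightarrow> 0 \<le> e \<Longrightarrow> filt Q b e m' \<gamma> f"
  unfolding filt_def
  by (auto intro: vge_mono [of "\<gamma> + e - k \<cdot> b" _ "\<gamma> - k \<cdot> b" for k] simp: algebra_simps)

lemma filt_zero_gap: "filt Q b e m \<gamma> f \<Longrightarrow> filt Q b 0 m' \<gamma> f"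
  by (auto simp: filt_def)

lemma filt_term:
  assumes "degree a < degree Q" "a \<noteq> 0 \<Longrightarrow> \<gamma> \<le> i \<cdot> b + u a"
    "m \<le> i \<Longrightarrow> a \<noteq> 0 \<Longrightarrow> \<gamma> + e \<le> i \<cdot> b + u a"
  shows "filt Q b e m \<gamma> (a * Q ^ i)"
  using assms unfolding filt_def adic_coeff_term [OF assms(1)]
  by (auto simp: vge_def diff_le_eq ac_simps)

lemma filt_imp_vge:
  assumes "degree Q > 0" "b \<le> u Q" "filt Q b e m \<gamma> f"
  shows "vge \<gamma> f"
proof -
  have "vge \<gamma> (adic_coeff Q f j * Q ^ j)" for j
  proof -
    have "vge (\<gamma> - j \<cdot> b) (adic_coeff Q f j)" using assms(3) by (auto simp: filt_def)
    moreover have "vge (j \<cdot> b) (Q ^ j)"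
      using val_power [of Q j] nat_scale_mono [OF assms(2), of j] assms(1)
      by (cases "Q = 0") (auto simp: vge_def)
    ultimately have "vge (\<gamma> - j \<cdot> b + j \<cdot> b) (adic_coeff Q f j * Q ^ j)" by (rule vge_mult)
    then show ?thesis by simp
  qed
  then have "vge \<gamma> (\<Sum>j\<le>degree f. adic_coeff Q f j * Q ^ j)" by (intro vge_sum)
  then show ?thesis using adic_expansion(1) [OF assms(1), of f] by simp
qed

lemma truncation_set_finite:
  assumes "degree Q > 0"
  shows "finite {nat_scale j (u Q) + u (adic_coeff Q f j) | j. adic_coeff Q f j \<noteq> 0}"
  using finite_adic_support [OF assms, of f] by (simp add: setcompr_eq_image)

lemma truncation_ge_iff:
  assumes "degree Q > 0" "f \<noteq> 0"
  shows "\<gamma> \<le> truncation v Q f \<longleftrightarrow> filt Q (u Q) 0 0 \<gamma> f"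
proof -
  have "{nat_scale j (u Q) + u (adic_coeff Q f j) | j. adic_coeff Q f j \<noteq> 0} \<noteq> {}"
    using adic_coeff_nonzero_exists [OF assms] by auto
  then show ?thesis
    unfolding truncation_def filt_def using truncation_set_finite [OF assms(1), of f]
    by (auto simp: Min_ge_iff vge_def diff_le_eq ac_simps)
qed

lemma truncation_le_term:
  assumes "degree Q > 0" "adic_coeff Q f j \<noteq> 0"
  shows "truncation v Q f \<le> j \<cdot> u Q + u (adic_coeff Q f j)"
  unfolding truncation_def using truncation_set_finite [OF assms(1), of f] assms(2)
  by (intro Min_le) auto

lemma truncation_le:
  assumes "degree Q > 0" "f \<noteq> 0"
  shows "truncation v Q f \<le> u f"
  using filt_imp_vge [OF assms(1) order_refl, of 0 0 "truncation v Q f" f]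
    truncation_ge_iff [OF assms, of "truncation v Q f"] assms(2) by (auto simp: vge_def)

lemma truncation_small:
  assumes "a \<noteq> 0" "degree a < degree Q"
  shows "truncation v Q a = u a"
proof -
  have "{nat_scale j (u Q) + u (adic_coeff Q a j) | j. adic_coeff Q a j \<noteq> 0} = {u a}"
    using assms by (auto simp: adic_coeff_small)
  then show ?thesis by (simp add: truncation_def)
qed


section \<open>Multiplicativity of truncations\<close>

text \<open>A workable substitute for a recursive definition: the remainder of a product of small
  polynomials keeps its value, and the carry \<open>h Q\<close> is larger by a uniform margin \<open>v(Q) - \<tau>\<close>. In practice
  \<open>\<tau>\<close> is the truncated value of \<open>Q\<close> at its predecessor. In degree \<open>1\<close> there is no carry, and every
  \<open>\<tau> < v(Q)\<close> will do.\<close>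

definition key :: "'k poly \<Rightarrow> 'g \<Rightarrow> bool" where
  "key Q \<tau> \<longleftrightarrow> lead_coeff Q = 1 \<and> 0 < degree Q \<and> \<tau> < u Q \<and>
     (\<forall>a c. a \<noteq> 0 \<longrightarrow> c \<noteq> 0 \<longrightarrow> degree a < degree Q \<longrightarrow> degree c < degree Q \<longrightarrow>
        (a * c) mod Q \<noteq> 0 \<and> u ((a * c) mod Q) = u a + u c \<and>
        ((a * c) div Q \<noteq> 0 \<longrightarrow> u a + u c \<le> \<tau> + u ((a * c) div Q)))"

lemma keyD:
  assumes "key Q \<tau>"
  shows "lead_coeff Q = 1" "0 < degree Q" "\<tau> < u Q" "Q \<noteq> 0"
  using assms by (auto simp: key_def)

lemma key_mult:
  assumes "key Q \<tau>" "a \<noteq> 0" "c \<noteq> 0" "degree a < degree Q" "degree c < degree Q"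
  obtains r h where "a * c = r + h * Q" "r = (a * c) mod Q" "r \<noteq> 0" "degree r < degree Q"
    "degree h < degree Q" "u r = u a + u c" "h \<noteq> 0 \<Longrightarrow> u a + u c \<le> \<tau> + u h"
proof -
  define r h where "r = (a * c) mod Q" and "h = (a * c) div Q"
  note d = keyD [OF assms(1)]
  have 1: "a * c = r + h * Q" by (simp add: r_def h_def)
  have 2: "r \<noteq> 0" "u r = u a + u c" "h \<noteq> 0 \<Longrightarrow> u a + u c \<le> \<tau> + u h"
    using assms unfolding key_def r_def h_def by auto
  have 3: "degree r < degree Q" using degree_mod_less' [OF d(4), of "a * c"] 2(1) by (simp add: r_def)
  have 4: "degree h < degree Q"
  proof (cases "h = 0")
    case False
    have "degree (h * Q) \<le> max (degree (a * c)) (degree r)"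
      using degree_diff_le_max [of "a * c" r] 1 by simp
    moreover have "degree (h * Q) = degree h + degree Q" using False d(4) by (rule degree_mult_eq)
    moreover have "degree (a * c) = degree a + degree c" using assms by (simp add: degree_mult_eq)
    ultimately show ?thesis using 3 assms(4,5) by linarith
  qed (use d in simp)
  show thesis by (rule that [OF 1 r_def 2(1) 3 4 2(2,3)])
qed

lemma filt_mult_term:
  assumes "key Q \<tau>" "\<tau> + e \<le> b" "0 \<le> e" "degree a < degree Q" "degree c < degree Q"
    and a: "a \<noteq> 0 \<Longrightarrow> \<gamma> \<le> i \<cdot> b + u a" "a \<noteq> 0 \<Longrightarrow> m \<le> i \<Longrightarrow> \<gamma> + e \<le> i \<cdot> b + u a"
    and c: "c \<noteq> 0 \<Longrightarrow> \<gamma>' \<le> j \<cdot> b + u c" "c \<noteq> 0 \<Longrightarrow> Suc n \<le> j \<Longrightarrow> \<gamma>' + e \<le> j \<cdot> b + u c"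
  shows "filt Q b e (m + n) (\<gamma> + \<gamma>') ((a * Q ^ i) * (c * Q ^ j))"
proof (cases "a = 0 \<or> c = 0")
  case False
  then have ac: "a \<noteq> 0" "c \<noteq> 0" by auto
  obtain r h where rh: "a * c = r + h * Q" "r \<noteq> 0" "degree r < degree Q"
    "degree h < degree Q" "u r = u a + u c" "h \<noteq> 0 \<Longrightarrow> u a + u c \<le> \<tau> + u h"
    using key_mult [OF assms(1) ac assms(4,5)] by metis
  have eq: "(a * Q ^ i) * (c * Q ^ j) = r * Q ^ (i + j) + h * Q ^ Suc (i + j)"
  proof -
    have "(a * Q ^ i) * (c * Q ^ j) = (a * c) * Q ^ (i + j)" by (simp add: power_add ac_simps)
    then show ?thesis unfolding rh(1) by (simp add: algebra_simps)
  qed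
  have "filt Q b e (m + n) (\<gamma> + \<gamma>') (r * Q ^ (i + j))"
  proof (rule filt_term [OF rh(3)])
    show "\<gamma> + \<gamma>' \<le> (i + j) \<cdot> b + u r"
      using add_mono [OF a(1) c(1)] ac rh(5) by (simp add: nat_scale_add algebra_simps)
    assume "m + n \<le> i + j"
    then consider "m \<le> i" | "Suc n \<le> j" by linarith
    then show "\<gamma> + \<gamma>' + e \<le> (i + j) \<cdot> b + u r"
    proof cases
      case 1
      show ?thesis
        using add_mono [OF a(2) c(1)] 1 ac rh(5) by (simp add: nat_scale_add algebra_simps)
    next
      case 2
      show ?thesis
        using add_mono [OF a(1) c(2)] 2 ac rh(5) by (simp add: nat_scale_add algebra_simps)
    qed
  qed
  moreover have "filt Q b e (m + n) (\<gamma> + \<gamma>') (h * Q ^ Suc (i + j))"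
  proof (cases "h = 0")
    case False
    have "(\<gamma> + \<gamma>') + ((u a + u c) + (\<tau> + e)) \<le> ((i \<cdot> b + u a) + (j \<cdot> b + u c)) + ((\<tau> + u h) + b)"
      by (intro add_mono a(1) c(1) ac rh(6) [OF False] assms(2))
    then have *: "\<gamma> + \<gamma>' + e \<le> Suc (i + j) \<cdot> b + u h"
      by (simp add: nat_scale_add algebra_simps)
    moreover from * assms(3) have "\<gamma> + \<gamma>' \<le> Suc (i + j) \<cdot> b + u h"
      by (metis add.right_neutral add_left_mono order_trans)
    ultimately show ?thesis by (intro filt_term [OF rh(4)])
  qed simp
  ultimately show ?thesis unfolding eq by (rule filt_add)
qed auto

text \<open>Multiplying the expansions term by term, each product \<open>a c\<close> of coefficients contributes its
  remainder at the expected index and a carry at the next index. The carry exceeds the expected value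
  by \<open>b - \<tau>\<close>, so it is negligible at precision \<open>e\<close>.\<close>

lemma filt_mult:
  assumes "key Q \<tau>" "\<tau> + e \<le> b" "0 \<le> e" "filt Q b e m \<gamma> f" "filt Q b e (Suc n) \<gamma>' g"
  shows "filt Q b e (m + n) (\<gamma> + \<gamma>') (f * g)"
proof -
  note d = keyD [OF assms(1)]
  let ?f = "adic_coeff Q f" and ?g = "adic_coeff Q g"
  have "f * g = (\<Sum>i\<le>degree f. ?f i * Q ^ i) * (\<Sum>j\<le>degree g. ?g j * Q ^ j)"
    using adic_expansion(1) [OF d(2), of f] adic_expansion(1) [OF d(2), of g] by simp
  also have "\<dots> = (\<Sum>i\<le>degree f. \<Sum>j\<le>degree g. (?f i * Q ^ i) * (?g j * Q ^ j))"
    by (rule sum_product)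
  also have "filt Q b e (m + n) (\<gamma> + \<gamma>') \<dots>"
  proof (intro filt_sum filt_mult_term [OF assms(1-3)] degree_adic_coeff [OF d(2)])
    fix i j
    show "?f i \<noteq> 0 \<Longrightarrow> \<gamma> \<le> i \<cdot> b + u (?f i)"
      "?f i \<noteq> 0 \<Longrightarrow> m \<le> i \<Longrightarrow> \<gamma> + e \<le> i \<cdot> b + u (?f i)"
      using assms(4) by (auto simp: filt_def vge_def diff_le_eq ac_simps)
    show "?g j \<noteq> 0 \<Longrightarrow> \<gamma>' \<le> j \<cdot> b + u (?g j)"
      "?g j \<noteq> 0 \<Longrightarrow> Suc n \<le> j \<Longrightarrow> \<gamma>' + e \<le> j \<cdot> b + u (?g j)"
      using assms(5) by (auto simp: filt_def vge_def diff_le_eq ac_simps)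
  qed
  finally show ?thesis .
qed

lemma filt_mult_0:
  assumes "key Q \<tau>" "\<tau> \<le> b" "filt Q b 0 m \<gamma> f" "filt Q b 0 m \<gamma>' g"
  shows "filt Q b 0 m' (\<gamma> + \<gamma>') (f * g)"
  using filt_mult [OF assms(1) _ _ assms(3) filt_zero_gap [OF assms(4)], of 0] assms(2) filt_zero_gap
  by fastforce

text \<open>The index \<open>\<delta>\<close> is the last one whose term has minimal value, \<open>\<kappa>\<close> is the value of its coefficient,
  and \<open>e\<close> is a lower bound for the distance to all later terms.\<close>

definition lead_at :: "'k poly \<Rightarrow> 'g \<Rightarrow> 'g \<Rightarrow> nat \<Rightarrow> 'g \<Rightarrow> 'k poly \<Rightarrow> bool" where
  "lead_at Q b e \<delta> \<kappa> f \<longleftrightarrow>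
     adic_coeff Q f \<delta> \<noteq> 0 \<and> u (adic_coeff Q f \<delta>) = \<kappa> \<and> filt Q b e (Suc \<delta>) (\<kappa> + \<delta> \<cdot> b) f"

lemma lead_at_mono:
  assumes "lead_at Q b e \<delta> \<kappa> f" "e' \<le> e"
  shows "lead_at Q b e' \<delta> \<kappa> f"
proof -
  have "\<kappa> + \<delta> \<cdot> b + e' - k \<cdot> b \<le> \<kappa> + \<delta> \<cdot> b + e - k \<cdot> b" for k
    using assms(2) by simp
  then show ?thesis using assms(1) vge_mono unfolding lead_at_def filt_def by blast
qed

text \<open>The last conclusion, on where \<open>e\<close> comes from, keeps \<open>e\<close> in every group that contains \<open>\<epsilon>\<close> and
  the values of the terms; this makes it comparable with elements of an archimedean subgroup.\<close>

lemma lead_at_exists: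
  assumes "degree Q > 0" "f \<noteq> 0" "0 < \<epsilon>"
  obtains e \<delta> \<kappa> where "lead_at Q b e \<delta> \<kappa> f" "0 < e" "e \<le> \<epsilon>"
    "e = \<epsilon> \<or> (\<exists>k l. adic_coeff Q f k \<noteq> 0 \<and> adic_coeff Q f l \<noteq> 0 \<and>
        e = (k \<cdot> b + u (adic_coeff Q f k)) - (l \<cdot> b + u (adic_coeff Q f l)))"
proof -
  let ?c = "adic_coeff Q f"
  define J where "J = {k. ?c k \<noteq> 0}"
  define val where "val k = k \<cdot> b + u (?c k)" for k
  have J: "finite J" "J \<noteq> {}"
    using finite_adic_support [OF assms(1)] adic_coeff_nonzero_exists [OF assms(1,2)]
    by (auto simp: J_def)
  define \<gamma> where "\<gamma> = Min (val ` J)"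
  define M where "M = {k\<in>J. val k = \<gamma>}"
  have "\<gamma> \<in> val ` J" unfolding \<gamma>_def using J by (intro Min_in) auto
  then have M: "finite M" "M \<noteq> {}" using J by (auto simp: M_def)
  define \<delta> where "\<delta> = Max M"
  have "\<delta> \<in> M" unfolding \<delta>_def using M by (rule Max_in)
  then have \<delta>: "\<delta> \<in> J" "val \<delta> = \<gamma>" by (auto simp: M_def)
  have ge: "\<gamma> \<le> val k" if "k \<in> J" for k
    unfolding \<gamma>_def using J that by (intro Min_le) auto
  define E where "E = insert \<epsilon> ((\<lambda>k. val k - \<gamma>) ` (J - M))"
  define e where "e = Min E"
  have E: "finite E" "E \<noteq> {}" using J by (auto simp: E_def)
  have eE: "e \<in> E" unfolding e_def by (rule Min_in [OF E])
  have "0 < x" if "x \<in> E" for x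
    using that assms(3) ge by (force simp: E_def M_def order.order_iff_strict)
  with eE have e0: "0 < e" by auto
  have le: "e \<le> \<epsilon>" unfolding e_def using E by (intro Min_le) (auto simp: E_def)
  have ek: "\<gamma> + e \<le> val k" if "k \<in> J" "\<delta> < k" for k
  proof -
    have "k \<notin> M" using that(2) M Max_ge [of M k] by (auto simp: \<delta>_def)
    then have "e \<le> val k - \<gamma>" unfolding e_def using E that by (intro Min_le) (auto simp: E_def)
    then show ?thesis by (simp add: le_diff_eq add.commute)
  qed
  have \<gamma>: "\<gamma> = u (?c \<delta>) + \<delta> \<cdot> b" using \<delta>(2) by (simp add: val_def add.commute)
  have "lead_at Q b e \<delta> (u (?c \<delta>)) f"
    unfolding lead_at_def filt_def
  proof (intro conjI allI impI)
    show "?c \<delta> \<noteq> 0" using \<delta>(1) by (simp add: J_def)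
    show "vge (u (?c \<delta>) + \<delta> \<cdot> b - k \<cdot> b) (?c k)" for k
      using ge [of k] unfolding \<gamma> [symmetric]
      by (auto simp: J_def vge_def val_def diff_le_eq add.commute)
    show "vge (u (?c \<delta>) + \<delta> \<cdot> b + e - k \<cdot> b) (?c k)" if "Suc \<delta> \<le> k" for k
      using ek [of k] that unfolding \<gamma> [symmetric]
      by (auto simp: J_def vge_def val_def diff_le_eq add.commute)
  qed simp
  moreover have "e = \<epsilon> \<or> (\<exists>k l. adic_coeff Q f k \<noteq> 0 \<and> adic_coeff Q f l \<noteq> 0 \<and>
        e = (k \<cdot> b + u (adic_coeff Q f k)) - (l \<cdot> b + u (adic_coeff Q f l)))"
    using eE \<delta> by (auto simp: E_def val_def J_def)
  ultimately show thesis using that e0 le by blast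
qed

lemma truncation_lead_at:
  assumes "lead_at Q (u Q) e \<delta> \<kappa> f" "0 < degree Q"
  shows "truncation v Q f = \<kappa> + \<delta> \<cdot> u Q"
proof (rule antisym)
  have f: "f \<noteq> 0" using assms(1) by (auto simp: lead_at_def)
  show "\<kappa> + \<delta> \<cdot> u Q \<le> truncation v Q f"
    using truncation_ge_iff [OF assms(2) f] assms(1) filt_zero_gap by (auto simp: lead_at_def)
  show "truncation v Q f \<le> \<kappa> + \<delta> \<cdot> u Q"
    using truncation_le_term [OF assms(2), of f \<delta>] assms(1) by (auto simp: lead_at_def add.commute)
qed

lemma lead_at_split:
  assumes "lead_at Q b e \<delta> \<kappa> f" "0 < degree Q" "0 \<le> e"
  shows "filt Q b e \<delta> (\<kappa> + \<delta> \<cdot> b) (f - adic_coeff Q f \<delta> * Q ^ \<delta>)"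
proof -
  let ?c = "adic_coeff Q f"
  have "adic_coeff Q (f - ?c \<delta> * Q ^ \<delta>) k = (if k = \<delta> then 0 else ?c k)" for k
    by (simp add: adic_coeff_diff adic_coeff_term [OF degree_adic_coeff [OF assms(2)]])
  then show ?thesis using assms(1) unfolding lead_at_def filt_def by (auto simp: Suc_le_eq)
qed

text \<open>As for Gauss's lemma: at index \<open>\<delta> + \<epsilon>\<close> only the product of the two last dominant terms
  contributes at precision \<open>e\<close>, so nothing can cancel it.\<close>

lemma lead_at_mult:
  assumes "key Q \<tau>" "\<tau> + e \<le> b" "0 < e" "lead_at Q b e \<delta> \<kappa> f" "lead_at Q b e \<epsilon> \<kappa>' g"
  shows "adic_coeff Q (f * g) (\<delta> + \<epsilon>) \<noteq> 0" "u (adic_coeff Q (f * g) (\<delta> + \<epsilon>)) = \<kappa> + \<kappa>'"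
proof -
  note d = keyD [OF assms(1)]
  note filt_mult' = filt_mult [OF assms(1,2) less_imp_le [OF assms(3)]]
  let ?a = "adic_coeff Q f \<delta>" and ?c = "adic_coeff Q g \<epsilon>"
  let ?\<gamma> = "\<kappa> + \<delta> \<cdot> b" and ?\<gamma>' = "\<kappa>' + \<epsilon> \<cdot> b"
  define f' g' where "f' = f - ?a * Q ^ \<delta>" and "g' = g - ?c * Q ^ \<epsilon>"
  have f': "filt Q b e \<delta> ?\<gamma> f'" and g': "filt Q b e \<epsilon> ?\<gamma>' g'"
    using lead_at_split assms(3-5) d(2) by (auto simp: f'_def g'_def)
  have f: "?a \<noteq> 0" "u ?a = \<kappa>" and g: "?c \<noteq> 0" "u ?c = \<kappa>'" "filt Q b e (Suc \<epsilon>) ?\<gamma>' g"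
    using assms(4,5) by (auto simp: lead_at_def)
  have a: "filt Q b e (Suc \<delta>) ?\<gamma> (?a * Q ^ \<delta>)"
    using f by (intro filt_term degree_adic_coeff d) (auto simp: add.commute)
  obtain r h where rh: "?a * ?c = r + h * Q" "r \<noteq> 0" "degree r < degree Q"
    "degree h < degree Q" "u r = u ?a + u ?c" "h \<noteq> 0 \<Longrightarrow> u ?a + u ?c \<le> \<tau> + u h"
    using key_mult [OF assms(1) f(1) g(1)] degree_adic_coeff [OF d(2)] by metis
  have "f * g = f' * g + (?a * Q ^ \<delta>) * g' + (?a * ?c) * (Q ^ \<delta> * Q ^ \<epsilon>)"
    by (simp add: f'_def g'_def algebra_simps)
  then have eq: "f * g - r * Q ^ (\<delta> + \<epsilon>) = f' * g + g' * (?a * Q ^ \<delta>) + h * Q ^ Suc (\<delta> + \<epsilon>)"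
    unfolding rh(1) by (simp add: power_add algebra_simps)
  have "filt Q b e (\<delta> + \<epsilon>) (?\<gamma> + ?\<gamma>') (f' * g)"
    using filt_mult' [OF f' g(3)] .
  moreover have "filt Q b e (\<delta> + \<epsilon>) (?\<gamma> + ?\<gamma>') (g' * (?a * Q ^ \<delta>))"
    using filt_mult' [OF g' a] by (simp add: ac_simps)
  moreover have "filt Q b e (\<delta> + \<epsilon>) (?\<gamma> + ?\<gamma>') (h * Q ^ Suc (\<delta> + \<epsilon>))"
  proof (cases "h = 0")
    case False
    have "(u ?a + u ?c) + (\<tau> + e) \<le> (\<tau> + u h) + b" by (intro add_mono rh(6) [OF False] assms(2))
    then have *: "?\<gamma> + ?\<gamma>' + e \<le> Suc (\<delta> + \<epsilon>) \<cdot> b + u h"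
      using f g by (simp add: nat_scale_add algebra_simps)
    have "?\<gamma> + ?\<gamma>' \<le> ?\<gamma> + ?\<gamma>' + e" using assms(3) by simp
    then show ?thesis using * by (intro filt_term [OF rh(4)]) (blast intro: order_trans)+
  qed simp
  ultimately have "filt Q b e (\<delta> + \<epsilon>) (?\<gamma> + ?\<gamma>') (f * g - r * Q ^ (\<delta> + \<epsilon>))"
    unfolding eq by (intro filt_add)
  then have "vge (?\<gamma> + ?\<gamma>' + e - (\<delta> + \<epsilon>) \<cdot> b) (adic_coeff Q (f * g - r * Q ^ (\<delta> + \<epsilon>)) (\<delta> + \<epsilon>))"
    by (auto simp: filt_def)
  then have "vge (u r + e) (adic_coeff Q (f * g) (\<delta> + \<epsilon>) - r)"
    using rh(5) f g by (simp add: adic_coeff_diff adic_coeff_term [OF rh(3)] nat_scale_add algebra_simps)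
  then have "vge (u r + e) (r - adic_coeff Q (f * g) (\<delta> + \<epsilon>))"
    by (metis minus_diff_eq vge_minus)
  then have "vgt (u r) (r - adic_coeff Q (f * g) (\<delta> + \<epsilon>))"
    using assms(3) unfolding vge_def vgt_def by (metis less_add_same_cancel1 order_less_le_trans)
  from val_close [OF rh(2) this] show "adic_coeff Q (f * g) (\<delta> + \<epsilon>) \<noteq> 0"
    "u (adic_coeff Q (f * g) (\<delta> + \<epsilon>)) = \<kappa> + \<kappa>'" using rh(5) f g by auto
qed

lemma truncation_mult:
  assumes "key Q \<tau>" "f \<noteq> 0" "g \<noteq> 0"
  shows "truncation v Q (f * g) = truncation v Q f + truncation v Q g"
proof (rule antisym)
  note d = keyD [OF assms(1)]
  have fg: "f * g \<noteq> 0" using assms by simp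
  show "truncation v Q f + truncation v Q g \<le> truncation v Q (f * g)"
    using filt_mult_0 [OF assms(1) less_imp_le [OF d(3)], of 0 "truncation v Q f" f "truncation v Q g" g 0]
      truncation_ge_iff [OF d(2)] assms(2,3) fg by blast
  have pos: "0 < u Q - \<tau>" using d(3) by simp
  obtain e1 \<delta> \<kappa> where 1: "lead_at Q (u Q) e1 \<delta> \<kappa> f" "0 < e1" "e1 \<le> u Q - \<tau>"
    using lead_at_exists [OF d(2) assms(2) pos] by metis
  obtain e2 \<epsilon> \<kappa>' where 2: "lead_at Q (u Q) e2 \<epsilon> \<kappa>' g" "0 < e2" "e2 \<le> u Q - \<tau>"
    using lead_at_exists [OF d(2) assms(3) pos] by metis
  define e where "e = min e1 e2"
  have e: "\<tau> + e \<le> u Q" "0 < e" using 1 2 by (auto simp: e_def le_diff_eq ac_simps min_def)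
  have "lead_at Q (u Q) e \<delta> \<kappa> f" "lead_at Q (u Q) e \<epsilon> \<kappa>' g"
    using lead_at_mono [OF 1(1)] lead_at_mono [OF 2(1)] by (auto simp: e_def)
  note lm = lead_at_mult [OF assms(1) e this]
  have "truncation v Q (f * g) \<le> (\<delta> + \<epsilon>) \<cdot> u Q + (\<kappa> + \<kappa>')"
    using truncation_le_term [OF d(2) lm(1)] lm(2) by simp
  also have "\<dots> = truncation v Q f + truncation v Q g"
    using truncation_lead_at [OF 1(1) d(2)] truncation_lead_at [OF 2(1) d(2)]
    by (simp add: nat_scale_add algebra_simps)
  finally show "truncation v Q (f * g) \<le> truncation v Q f + truncation v Q g" .
qed

lemma truncation_add:
  assumes "degree Q > 0" "f + g \<noteq> 0" "f \<noteq> 0 \<Longrightarrow> \<gamma> \<le> truncation v Q f" "g \<noteq> 0 \<Longrightarrow> \<gamma> \<le> truncation v Q g"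
  shows "\<gamma> \<le> truncation v Q (f + g)"
proof -
  have "filt Q (u Q) 0 0 \<gamma> f" "filt Q (u Q) 0 0 \<gamma> g"
    using truncation_ge_iff [OF assms(1)] assms(3,4) filt_0 by metis+
  then show ?thesis using truncation_ge_iff [OF assms(1,2)] filt_add by blast
qed

text \<open>Here the truncation at \<open>P\<close> is a valuation below \<open>v\<close> that agrees with \<open>v\<close> in degrees less than
  that of \<open>Q\<close>. In \<open>a c = h Q + r\<close> the two sides with \<open>a\<close>, \<open>c\<close>, \<open>h\<close>, \<open>r\<close> are thus measured
  correctly, while the value of \<open>Q\<close> jumps, and this makes \<open>h Q\<close> negligible.\<close>

lemma key_step:
  assumes P: "key P \<tau>" and Q: "lead_coeff Q = 1" "truncation v P Q < u Q"
    and stable: "\<And>f. f \<noteq> 0 \<Longrightarrow> degree f < degree Q \<Longrightarrow> truncation v P f = u f"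
  shows "key Q (truncation v P Q)"
proof -
  note d = keyD [OF P]
  have Q0: "Q \<noteq> 0" using Q(1) by auto
  have dQ: "0 < degree Q"
    using truncation_small [OF Q0, of P] Q(2) d(2) by (cases "degree Q = 0") auto
  have "(a * c) mod Q \<noteq> 0 \<and> u ((a * c) mod Q) = u a + u c \<and>
        ((a * c) div Q \<noteq> 0 \<longrightarrow> u a + u c \<le> truncation v P Q + u ((a * c) div Q))"
    if ac: "a \<noteq> 0" "c \<noteq> 0" "degree a < degree Q" "degree c < degree Q" for a c
  proof -
    define r h where "r = (a * c) mod Q" and "h = (a * c) div Q"
    have eq: "a * c = r + h * Q" by (simp add: r_def h_def)
    have r: "r \<noteq> 0 \<Longrightarrow> degree r < degree Q"
      using degree_mod_less' [OF Q0, of "a * c"] by (simp add: r_def)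
    have tac: "truncation v P (a * c) = u a + u c"
      using truncation_mult [OF P ac(1,2)] stable ac by simp
    show ?thesis
    proof (cases "h = 0")
      case True
      then have "r = a * c" using eq by simp
      then show ?thesis using True ac by (simp add: val_mult flip: r_def h_def)
    next
      case False
      have "degree h < degree Q"
      proof (rule ccontr)
        assume "\<not> ?thesis"
        moreover have "degree (h * Q) = degree h + degree Q" using False Q0 by (rule degree_mult_eq)
        moreover have "degree (a * c) = degree a + degree c" using ac by (simp add: degree_mult_eq)
        moreover have "degree (h * Q) \<le> max (degree (a * c)) (degree r)"
          using degree_diff_le_max [of "a * c" r] eq by simp
        ultimately show False using ac r dQ by (cases "r = 0") auto
      qed
      then have th: "truncation v P h = u h" using stable False by blast
      have thQ: "truncation v P (h * Q) = u h + truncation v P Q"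
        using truncation_mult [OF P False Q0] th by simp
      have uhQ: "u (h * Q) = u h + u Q" using False Q0 by (rule val_mult)
      have hQ: "h * Q = a * c + (- r)" "h * Q \<noteq> 0" using eq False Q0 by auto
      have tr: "truncation v P (- r) = u r" if "r \<noteq> 0"
        using stable [of "- r"] r that by simp
      have key: "\<gamma> \<le> u h + truncation v P Q"
        if "\<gamma> \<le> u a + u c" "r \<noteq> 0 \<Longrightarrow> \<gamma> \<le> u r" for \<gamma>
        using truncation_add [OF d(2), of "a * c" "- r" \<gamma>] that tac tr hQ thQ ac by auto
      have uac: "u (a * c) = u a + u c" using ac by (simp add: val_mult)
      have small: "r \<noteq> 0 \<and> u r = u a + u c"
      proof (cases "r \<noteq> 0 \<and> u r < u a + u c")
        case True
        then have "u r \<le> u h + truncation v P Q" by (intro key) auto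
        also have "\<dots> < u (h * Q)" using uhQ Q(2) by simp
        finally have "vgt (u r) (- (h * Q))" by (simp add: vgt_def)
        moreover have "vgt (u r) (a * c)" using True uac by (auto simp: vgt_def)
        ultimately have "vgt (u r) (a * c + (- (h * Q)))" by (intro vgt_add)
        then show ?thesis using eq True by (auto simp: vgt_def)
      next
        case False
        then have "u a + u c \<le> u h + truncation v P Q" using key [of "u a + u c"] by auto
        also have "\<dots> < u (h * Q)" using uhQ Q(2) by simp
        finally have "vgt (u (a * c)) (a * c - r)" using uac eq by (auto simp: vgt_def)
        from val_close [OF _ this] ac uac show ?thesis by simp
      qed
      then show ?thesis using key [of "u a + u c"] by (simp add: add.commute flip: r_def h_def)
    qed
  qed
  then show ?thesis unfolding key_def using Q dQ by blast
qed

text \<open>Euclid's algorithm: dividing \<open>Q\<close> by a remainder \<open>a c mod Q\<close> of positive degree yields a multiple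
  of \<open>c\<close> with a remainder of smaller degree, which is nonzero because products of small polynomials
  never vanish modulo \<open>Q\<close>.\<close>

lemma key_inverse:
  assumes "key Q \<tau>" "c \<noteq> 0" "degree c < degree Q"
  obtains a where "a \<noteq> 0" "degree a < degree Q" "(a * c) mod Q = 1"
proof -
  note d = keyD [OF assms(1)]
  let ?P = "\<lambda>n. \<exists>a. a \<noteq> 0 \<and> degree a < degree Q \<and> degree ((a * c) mod Q) = n"
  have "?P (degree ((1 * c) mod Q))" using d(2) by (intro exI [of _ 1]) auto
  then have "?P (LEAST n. ?P n)" by (rule LeastI)
  then obtain a where a: "a \<noteq> 0" "degree a < degree Q"
    "degree ((a * c) mod Q) = (LEAST n. ?P n)" by blast
  define s where "s = (a * c) mod Q"
  obtain s0: "s \<noteq> 0" "degree s < degree Q"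
    using key_mult [OF assms(1) a(1) assms(2) a(2) assms(3)] unfolding s_def by metis
  have "degree s = 0"
  proof (rule ccontr)
    assume ds: "degree s \<noteq> 0"
    define q t where "q = Q div s" and "t = Q mod s"
    have Q: "Q = q * s + t" by (simp add: q_def t_def)
    have q0: "q \<noteq> 0" using s0 Q d(4)
      by (metis add.left_neutral degree_mod_less' mult_zero_left not_less_iff_gr_or_eq t_def)
    have "degree (q * s) \<le> max (degree Q) (degree t)"
      using degree_diff_le_max [of Q t] Q by simp
    moreover have "degree t < degree s" using degree_mod_less [OF s0(1), of Q] ds by (auto simp: t_def)
    ultimately have dq: "degree q < degree Q" using degree_mult_eq [OF q0 s0(1)] s0 ds by auto
    have "(q * s) mod Q \<noteq> 0"
      using key_mult [OF assms(1) q0 s0(1) dq s0(2)] by metis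
    then have t0: "t \<noteq> 0" using Q by (metis add.right_neutral mod_self)
    define a' where "a' = (- q * a) mod Q"
    have a'0: "a' \<noteq> 0" "degree a' < degree Q"
      using key_mult [OF assms(1), of "- q" a] q0 a dq unfolding a'_def by (metis degree_minus neg_equal_0_iff_equal)+
    have "(a' * c) mod Q = (- q * (a * c)) mod Q"
      unfolding a'_def by (simp add: mod_mult_left_eq mult.assoc)
    also have "\<dots> = (- q * s) mod Q" unfolding s_def by (simp add: mod_mult_right_eq)
    also have "- q * s = t - Q" using Q by simp
    also have "(t - Q) mod Q = t mod Q" by (simp add: poly_mod_diff_left)
    also have "t mod Q = t" using \<open>degree t < degree s\<close> s0 by (intro mod_poly_less) auto
    finally have "?P (degree t)" using a'0 by blast
    then have "(LEAST n. ?P n) \<le> degree t" by (rule Least_le)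
    then show False using a(3) \<open>degree t < degree s\<close> by (simp add: s_def)
  qed
  then obtain x where x: "s = [:x:]" "x \<noteq> 0" using s0 by (metis degree_eq_zeroE pCons_0_0)
  have "(smult (inverse x) a * c) mod Q = smult (inverse x) s"
    by (simp add: s_def mod_smult_left)
  also have "\<dots> = 1" using x by (simp add: one_pCons)
  finally show thesis using that [of "smult (inverse x) a"] a x by simp
qed

lemma key_linear:
  assumes "lead_coeff Q = 1" "degree Q = 1" "\<tau> < u Q"
  shows "key Q \<tau>"
proof -
  have "(a * c) mod Q \<noteq> 0 \<and> u ((a * c) mod Q) = u a + u c \<and>
        ((a * c) div Q \<noteq> 0 \<longrightarrow> u a + u c \<le> \<tau> + u ((a * c) div Q))"
    if "a \<noteq> 0" "c \<noteq> 0" "degree a < degree Q" "degree c < degree Q" for a c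
  proof -
    have "degree (a * c) < degree Q" using that assms(2) by (simp add: degree_mult_eq)
    then have "(a * c) mod Q = a * c" "(a * c) div Q = 0"
      by (simp_all add: mod_poly_less div_poly_less)
    then show ?thesis using that by (simp add: val_mult)
  qed
  then show ?thesis using assms unfolding key_def by auto
qed


section \<open>The next key polynomial\<close>

lemma filt_gain: "filt Q b e 0 \<gamma> f \<Longrightarrow> filt Q b 0 0 (\<gamma> + e) f"
  by (auto simp: filt_def)

lemma degree_expansion_less:
  fixes c :: "nat \<Rightarrow> 'a::field poly"
  assumes "\<And>j. j < n \<Longrightarrow> degree (c j) < degree Q" "0 < n" "0 < degree Q"
  shows "degree (\<Sum>j<n. c j * Q ^ j) < n * degree Q"
proof (rule degree_sum_less)
  fix j assume "j \<in> {..<n}"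
  then have "j < n" by simp
  have "degree (c j * Q ^ j) \<le> degree (c j) + j * degree Q"
    using degree_mult_le [of "c j" "Q ^ j"] degree_power_le [of Q j] by (simp add: mult.commute [of j])
  also have "\<dots> < Suc j * degree Q" using assms(1) [OF \<open>j < n\<close>] by simp
  also have "\<dots> \<le> n * degree Q" using \<open>j < n\<close> by (intro mult_le_mono1) simp
  finally show "degree (c j * Q ^ j) < n * degree Q" .
qed (use assms in simp)

lemma lead_at_0:
  assumes "lead_at Q (u Q) e 0 \<kappa> f" "0 < degree Q" "0 < e"
  shows "u f = \<kappa>"
proof -
  let ?c = "adic_coeff Q f 0"
  have c: "?c \<noteq> 0" "u ?c = \<kappa>" using assms(1) by (auto simp: lead_at_def)
  have "filt Q (u Q) e 0 \<kappa> (f - ?c)" using lead_at_split [OF assms(1,2)] assms(3) by simp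
  then have "vge (\<kappa> + e) (f - ?c)" using filt_imp_vge [OF assms(2) order_refl filt_gain] by blast
  then have "vge (\<kappa> + e) (?c - f)" by (metis minus_diff_eq vge_minus)
  then have "vgt (u ?c) (?c - f)"
    using assms(3) c unfolding vge_def vgt_def by (metis less_add_same_cancel1 order_less_le_trans)
  from val_close(2) [OF c(1) this] c(2) show ?thesis by simp
qed

text \<open>Divide \<open>f\<close> by the coefficient \<open>c\<close> of its last dominant term, that is, multiply by an inverse
  of \<open>c\<close> modulo \<open>Q\<close>, and keep only the remainders of the dominant terms. What is thrown away has
  larger value, so the result still has a value exceeding its truncation.\<close>

lemma homogeneous_exists:
  assumes Q: "key Q \<tau>" and f: "f \<noteq> 0" "truncation v Q f < u f"
  obtains R where "lead_coeff R = 1" "degree R \<le> degree f" "truncation v Q R < u R"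
    "homogeneous_expansion v Q R"
proof -
  note d = keyD [OF Q]
  let ?c = "adic_coeff Q f" and ?\<beta> = "u Q"
  obtain e \<delta> \<kappa> where lead: "lead_at Q ?\<beta> e \<delta> \<kappa> f" "0 < e"
    using lead_at_exists [OF d(2) f(1)] d(3) by (metis diff_gt_0_iff_gt)
  define \<gamma> where "\<gamma> = \<kappa> + \<delta> \<cdot> ?\<beta>"
  have tr: "truncation v Q f = \<gamma>" using truncation_lead_at [OF lead(1) d(2)] by (simp add: \<gamma>_def)
  have c\<delta>: "?c \<delta> \<noteq> 0" "u (?c \<delta>) = \<kappa>" using lead by (auto simp: lead_at_def)
  have cdeg: "degree (?c j) < degree Q" for j by (rule degree_adic_coeff [OF d(2)])
  have ge: "\<gamma> \<le> j \<cdot> ?\<beta> + u (?c j)" if "?c j \<noteq> 0" for j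
    using lead(1) that by (auto simp: lead_at_def filt_def vge_def diff_le_eq \<gamma>_def ac_simps)
  have gt: "\<gamma> < j \<cdot> ?\<beta> + u (?c j)" if "?c j \<noteq> 0" "\<delta> < j" for j
  proof -
    have "\<gamma> + e \<le> j \<cdot> ?\<beta> + u (?c j)"
      using lead(1) that by (auto simp: lead_at_def filt_def vge_def diff_le_eq \<gamma>_def ac_simps Suc_le_eq)
    then show ?thesis using lead(2) by (metis less_add_same_cancel1 order_less_le_trans)
  qed
  have \<delta>0: "0 < \<delta>"
  proof (rule ccontr)
    assume "\<not> 0 < \<delta>"
    then have "u f = \<gamma>" using lead_at_0 [OF _ d(2) lead(2)] lead(1) by (simp add: \<gamma>_def)
    then show False using f tr by simp
  qed
  obtain a where a: "a \<noteq> 0" "degree a < degree Q" "(a * ?c \<delta>) mod Q = 1"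
    using key_inverse [OF Q c\<delta>(1) cdeg] by blast
  have ua: "u a + \<kappa> = 0"
    using key_mult [OF Q a(1) c\<delta>(1) a(2) cdeg] a(3) c\<delta>(2) by (metis val_1)
  have ua': "u a + \<gamma> = \<delta> \<cdot> ?\<beta>" using ua by (simp add: \<gamma>_def add.assoc [symmetric])
  define dom where "dom j \<longleftrightarrow> ?c j \<noteq> 0 \<and> j \<cdot> ?\<beta> + u (?c j) = \<gamma>" for j
  define r where "r j = (if dom j then (a * ?c j) mod Q else 0)" for j
  have r\<delta>: "r \<delta> = 1" using c\<delta> a(3) by (simp add: r_def dom_def \<gamma>_def add.commute)
  have rdeg: "degree (r j) < degree Q" for j
    using degree_mod_less [OF d(4), of "a * ?c j"] d(2) by (auto simp: r_def)
  have rbig: "r j = 0" if "\<delta> < j" for j using gt [of j] that by (auto simp: r_def dom_def)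
  define R where "R = Q ^ \<delta> + (\<Sum>j<\<delta>. r j * Q ^ j)"
  have R_alt: "R = (\<Sum>j\<le>degree f. r j * Q ^ j)"
  proof -
    have "\<delta> \<le> degree f" using adic_expansion(2) [OF d(2)] c\<delta>(1) by (meson not_less)
    then have "(\<Sum>j\<le>degree f. r j * Q ^ j) = (\<Sum>j\<le>\<delta>. r j * Q ^ j)"
      using rbig by (intro sum.mono_neutral_right) auto
    also have "\<dots> = R" unfolding R_def lessThan_Suc_atMost [symmetric] by (simp add: r\<delta> add.commute)
    finally show ?thesis ..
  qed
  have "vgt (\<delta> \<cdot> ?\<beta>) (a * ?c j * Q ^ j - r j * Q ^ j)" for j
  proof (cases "?c j = 0")
    case False
    show ?thesis
    proof (cases "dom j")
      case True
      obtain s h where rh: "a * ?c j = s + h * Q" "s = (a * ?c j) mod Q"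
          "h \<noteq> 0 \<Longrightarrow> u a + u (?c j) \<le> \<tau> + u h"
        using key_mult [OF Q a(1) False a(2) cdeg] by metis
      have "r j = s" using True rh(2) by (simp add: r_def)
      then have "a * ?c j * Q ^ j - r j * Q ^ j = h * Q ^ Suc j"
        unfolding rh(1) by (simp add: algebra_simps)
      moreover have "\<delta> \<cdot> ?\<beta> < u (h * Q ^ Suc j)" if "h \<noteq> 0"
      proof -
        have "\<delta> \<cdot> ?\<beta> = u a + (j \<cdot> ?\<beta> + u (?c j))" using ua' True by (simp add: dom_def)
        also have "\<dots> = (u a + u (?c j)) + j \<cdot> ?\<beta>" by (simp add: ac_simps)
        also have "\<dots> \<le> (\<tau> + u h) + j \<cdot> ?\<beta>" by (intro add_right_mono rh(3) that)
        also have "\<dots> < (?\<beta> + u h) + j \<cdot> ?\<beta>" by (intro add_strict_right_mono d(3))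
        also have "\<dots> = u h + Suc j \<cdot> ?\<beta>" by (simp add: ac_simps)
        also have "\<dots> = u (h * Q ^ Suc j)"
          using val_mult [OF that, of "Q ^ Suc j"] val_power [OF d(4), of "Suc j"] d(4) by simp
        finally show ?thesis .
      qed
      ultimately show ?thesis by (auto simp: vgt_def)
    next
      case ndom: False
      have "\<delta> \<cdot> ?\<beta> = u a + \<gamma>" using ua' by simp
      also have "\<dots> < u a + (j \<cdot> ?\<beta> + u (?c j))"
        using ge [OF False] ndom False by (intro add_strict_left_mono) (auto simp: dom_def)
      also have "\<dots> = u (a * ?c j * Q ^ j)"
        using False a(1) d(4) by (simp add: val_mult val_power ac_simps)
      finally show ?thesis using ndom by (simp add: r_def vgt_def)
    qed
  qed (simp add: r_def dom_def)
  then have "vgt (\<delta> \<cdot> ?\<beta>) (\<Sum>j\<le>degree f. a * ?c j * Q ^ j - r j * Q ^ j)"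
    by (intro vgt_sum)
  moreover have "a * f = (\<Sum>j\<le>degree f. a * ?c j * Q ^ j)"
    using adic_expansion(1) [OF d(2), of f] by (metis (no_types, lifting) mult.assoc sum.cong sum_distrib_left)
  ultimately have "vgt (\<delta> \<cdot> ?\<beta>) (a * f - R)" unfolding R_alt by (simp add: sum_subtractf)
  moreover have "vgt (\<delta> \<cdot> ?\<beta>) (a * f)"
    using f tr a(1) unfolding ua' [symmetric] by (simp add: vgt_def val_mult)
  ultimately have vR: "vgt (\<delta> \<cdot> ?\<beta>) R" using vgt_diff by fastforce
  have degS: "degree (\<Sum>j<\<delta>. r j * Q ^ j) < \<delta> * degree Q"
    using degree_expansion_less rdeg \<delta>0 d(2) by blast
  have degP: "degree (Q ^ \<delta>) = \<delta> * degree Q"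
    using d(2) by (subst degree_power_eq) auto
  have degR: "degree R = \<delta> * degree Q" using degS degP by (simp add: R_def degree_add_eq_left)
  have monic: "lead_coeff R = 1"
  proof -
    have "R = (\<Sum>j<\<delta>. r j * Q ^ j) + Q ^ \<delta>" by (simp add: R_def)
    then have "lead_coeff R = lead_coeff (Q ^ \<delta>)"
      using lead_coeff_add_le [of "\<Sum>j<\<delta>. r j * Q ^ j" "Q ^ \<delta>"] degS degP by (simp only:)
    also have "\<dots> = lead_coeff Q ^ \<delta>" by (rule lead_coeff_power)
    finally show ?thesis unfolding d(1) by simp
  qed
  have "adic_coeff Q (1 * Q ^ \<delta>) \<delta> = 1"
    using adic_coeff_term [of 1 Q \<delta> \<delta>] d(2) by simp
  moreover have "adic_coeff Q (\<Sum>j<\<delta>. r j * Q ^ j) \<delta> = 0"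
    using adic_coeff_nonzero_degree [OF _ d(2), of "\<Sum>j<\<delta>. r j * Q ^ j" \<delta>] degS by linarith
  ultimately have "adic_coeff Q R \<delta> = 1" by (simp add: R_def adic_coeff_add)
  then have "truncation v Q R \<le> \<delta> \<cdot> ?\<beta>" using truncation_le_term [OF d(2), of R \<delta>] by simp
  moreover have "R \<noteq> 0" using monic by auto
  ultimately have unst: "truncation v Q R < u R" using vR by (auto simp: vgt_def)
  have "j \<cdot> ?\<beta> + u (r j) = \<delta> \<cdot> ?\<beta>" if "r j \<noteq> 0" for j
  proof -
    have dj: "dom j" "?c j \<noteq> 0" using that by (auto simp: r_def dom_def split: if_splits)
    have "u (r j) = u a + u (?c j)"
      using key_mult [OF Q a(1) dj(2) a(2) cdeg] dj by (metis r_def)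
    then have "j \<cdot> ?\<beta> + u (r j) = u a + (j \<cdot> ?\<beta> + u (?c j))" by (simp add: ac_simps)
    also have "\<dots> = u a + \<gamma>" using dj(1) by (simp add: dom_def)
    finally show ?thesis using ua' by simp
  qed
  then have hom: "homogeneous_expansion v Q R"
    unfolding homogeneous_expansion_def R_def using \<delta>0 rdeg
    by (intro exI [of _ \<delta>] exI [of _ r] conjI) auto
  have "degree R \<le> degree f" using adic_coeff_nonzero_degree [OF c\<delta>(1) d(2)] degR by simp
  from that [OF monic this unst hom] show thesis .
qed

abbreviation unstable :: "'k poly \<Rightarrow> 'k poly \<Rightarrow> bool" where
  "unstable Q f \<equiv> truncation v Q f < u f"

text \<open>The homogeneous polynomial obtained from one of least degree has least degree as well.\<close>

lemma next_exists:
  assumes "key Q \<tau>" "f \<noteq> 0" "unstable Q f"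
  obtains R where "least_degree_monic (unstable Q) R" "homogeneous_expansion v Q R"
proof -
  let ?P = "\<lambda>n. \<exists>R. lead_coeff R = 1 \<and> unstable Q R \<and> degree R = n"
  obtain R0 where R0: "lead_coeff R0 = 1" "unstable Q R0"
    using homogeneous_exists [OF assms] by metis
  then have "?P (degree R0)" by blast
  then have "?P (LEAST n. ?P n)" by (rule LeastI)
  then obtain R where R: "lead_coeff R = 1" "unstable Q R" "degree R = (LEAST n. ?P n)" by blast
  have min: "degree R \<le> degree S" if "lead_coeff S = 1" "unstable Q S" for S
    unfolding R(3) using that by (intro Least_le) blast
  have "R \<noteq> 0" using R(1) by auto
  then obtain S where S: "lead_coeff S = 1" "degree S \<le> degree R" "unstable Q S"
    "homogeneous_expansion v Q S"
    using homogeneous_exists [OF assms(1) _ R(2)] by metis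
  show thesis
    by (rule that [OF _ S(4)]) (use S min in \<open>auto simp: least_degree_monic_def intro: order_trans\<close>)
qed

lemma least_stable:
  assumes "key Q \<tau>" "least_degree_monic (unstable Q) R" "f \<noteq> 0" "degree f < degree R"
  shows "truncation v Q f = u f"
proof (rule ccontr)
  assume "truncation v Q f \<noteq> u f"
  with truncation_le [OF keyD(2) [OF assms(1)] assms(3)] have "unstable Q f" by simp
  then obtain S where "lead_coeff S = 1" "degree S \<le> degree f" "unstable Q S"
    using homogeneous_exists [OF assms(1,3)] by metis
  then show False using assms(2,4) by (auto simp: least_degree_monic_def)
qed

lemma key_next:
  assumes "key Q \<tau>" "least_degree_monic (unstable Q) R"
  shows "key R (truncation v Q R)" "degree Q \<le> degree R"
proof -
  have R: "lead_coeff R = 1" "unstable Q R" using assms(2) by (auto simp: least_degree_monic_def)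
  show "key R (truncation v Q R)"
    using key_step [OF assms(1) R] least_stable [OF assms] by blast
  have "R \<noteq> 0" using R(1) by auto
  then show "degree Q \<le> degree R" using truncation_small [of R Q] R(2)
    by (metis less_irrefl not_less)
qed

section \<open>Key polynomials of the same degree\<close>

lemma monic_diff_degree:
  assumes "lead_coeff R = 1" "lead_coeff Q = 1" "degree R = degree Q" "0 < degree Q"
  shows "degree (R - Q :: 'k poly) < degree Q"
proof -
  have "R - Q = 0 \<or> degree (R - Q) < degree Q"
  proof (cases "R - Q = 0")
    case False
    then show ?thesis
      using assms by (intro disjI2 degree_less_if_less_eqI) (auto simp: degree_diff_le)
  qed simp
  then show "degree (R - Q) < degree Q" using assms(4) by auto
qed

lemma filt_same_degree:
  assumes "lead_coeff R = 1" "lead_coeff Q = 1" "degree R = degree Q" "0 < degree Q"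
    "\<gamma> \<le> b" "vge \<gamma> (R - Q)"
  shows "filt Q b 0 m \<gamma> R"
proof -
  have "filt Q b 0 m \<gamma> (1 * Q ^ 1 + (R - Q) * Q ^ 0)"
    using assms monic_diff_degree [OF assms(1-4)]
    by (intro filt_add filt_term) (auto simp: vge_def)
  then show ?thesis by simp
qed

text \<open>Within the degree of \<open>Q\<close>, every monic polynomial of larger value is a legitimate successor of \<open>Q\<close>.
  This is the freedom used in the construction of the sequence.\<close>

lemma same_degree_next:
  assumes "key Q \<tau>" "lead_coeff R = 1" "degree R = degree Q" "u Q < u R"
  shows "least_degree_monic (unstable Q) R" "homogeneous_expansion v Q R" "truncation v Q R = u Q"
proof -
  note d = keyD [OF assms(1)]
  define z where "z = R - Q"
  have dz: "degree z < degree Q" using monic_diff_degree assms d by (simp add: z_def)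
  have R: "R = Q ^ 1 + (\<Sum>j<1. z * Q ^ j)" by (simp add: z_def)
  have R0: "R \<noteq> 0" using assms(2) by auto
  have "vgt (u (- Q)) (- Q - z)" using assms(4) by (auto simp: z_def vgt_def)
  from val_close [OF _ this] d(4) have z: "z \<noteq> 0" "u z = u Q" by auto
  show tr: "truncation v Q R = u Q"
  proof (rule antisym)
    show "u Q \<le> truncation v Q R"
      using filt_same_degree [OF assms(2) d(1) assms(3) d(2) order_refl] z truncation_ge_iff [OF d(2) R0]
      by (auto simp: vge_def z_def)
    have "adic_coeff Q (1 * Q ^ 1 + z * Q ^ 0) 1 = 1"
      using adic_coeff_term [of 1 Q 1 1] adic_coeff_term [OF dz, of 0 1] d(2)
      by (simp only: adic_coeff_add) auto
    then have "adic_coeff Q R 1 = 1" by (simp add: z_def)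
    then show "truncation v Q R \<le> u Q" using truncation_le_term [OF d(2), of R 1] by simp
  qed
  have "degree Q \<le> degree S" if "lead_coeff S = 1" "unstable Q S" for S
    using truncation_small [of S Q] that by (cases "S = 0") (auto simp: not_less [symmetric])
  then show "least_degree_monic (unstable Q) R"
    using assms tr by (auto simp: least_degree_monic_def)
  show "homogeneous_expansion v Q R"
    unfolding homogeneous_expansion_def
    by (rule exI [of _ 1], intro conjI exI [of _ "\<lambda>_. z"]) (use R dz z in auto)
qed

lemma same_degree_next_greater:
  assumes "key Q \<tau>" "least_degree_monic (unstable Q) R" "degree R = degree Q"
  shows "u Q < u R"
proof (rule ccontr)
  note d = keyD [OF assms(1)]
  assume "\<not> u Q < u R"
  then have le: "u R \<le> u Q" by simp
  have R: "lead_coeff R = 1" "unstable Q R" using assms(2) by (auto simp: least_degree_monic_def)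
  have R0: "R \<noteq> 0" using R(1) by auto
  have "vge (u R) (R - Q)" using le by (intro vge_diff) (auto simp: vge_def)
  from filt_same_degree [OF R(1) d(1) assms(3) d(2) le this] have "u R \<le> truncation v Q R"
    using truncation_ge_iff [OF d(2) R0] by blast
  with R(2) show False by simp
qed

lemma filt_power_0:
  assumes "key Q \<tau>" "\<tau> \<le> b" "filt Q b 0 0 \<gamma> f"
  shows "filt Q b 0 0 (n \<cdot> \<gamma>) (f ^ n)"
proof (induction n)
  case 0
  have "filt Q b 0 0 0 (1 * Q ^ 0)" using keyD [OF assms(1)] by (intro filt_term) auto
  then show ?case by simp
next
  case (Suc n)
  then show ?case using filt_mult_0 [OF assms] by simp
qed

text \<open>At the better polynomial \<open>R\<close> the truncation is a valuation giving \<open>Q\<close> its true value, so no term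
  of the \<open>Q\<close>-expansion can lose value when it is expanded again.\<close>

lemma truncation_same_degree_mono:
  assumes "key R \<tau>" "lead_coeff Q = 1" "degree Q = degree R" "u Q \<le> u R" "f \<noteq> 0"
  shows "truncation v Q f \<le> truncation v R f"
proof -
  note d = keyD [OF assms(1)]
  have dQ: "degree Q > 0" using assms(3) d(2) by simp
  let ?\<gamma> = "truncation v Q f" and ?c = "adic_coeff Q f"
  note m0 = filt_mult_0 [OF assms(1) less_imp_le [OF d(3)], of 0]
  have "vge (u Q) (Q - R)" using assms(4) by (intro vge_diff) (auto simp: vge_def)
  then have Q: "filt R (u R) 0 0 (u Q) Q"
    by (intro filt_same_degree assms d)
  have "filt R (u R) 0 0 ?\<gamma> (?c j * Q ^ j)" for j
  proof (cases "?c j = 0")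
    case False
    have "filt R (u R) 0 0 (u (?c j)) (?c j * R ^ 0)"
      using degree_adic_coeff [OF dQ, of f j] assms(3) by (intro filt_term) auto
    then have "filt R (u R) 0 0 (u (?c j) + j \<cdot> u Q) (?c j * Q ^ j)"
      using m0 filt_power_0 [OF assms(1) less_imp_le [OF d(3)] Q, of j] by simp
    moreover have "?\<gamma> \<le> u (?c j) + j \<cdot> u Q"
      using truncation_le_term [OF dQ False] by (simp add: add.commute)
    ultimately show ?thesis
      unfolding filt_def using vge_mono [of "u (?c j) + j \<cdot> u Q - k \<cdot> u R" _ "?\<gamma> - k \<cdot> u R" for k]
      by (auto intro: diff_right_mono)
  qed simp
  then have "filt R (u R) 0 0 ?\<gamma> (\<Sum>j\<le>degree f. ?c j * Q ^ j)" by (intro filt_sum)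
  then show ?thesis
    using truncation_ge_iff [OF d(2) assms(5)] adic_expansion(1) [OF dQ, of f] by simp
qed

end

section \<open>Rank one and residue characteristic zero\<close>

locale rank_one_valuation = poly_valuation v
  for v :: "'k::field poly fract \<Rightarrow> 'g::linordered_ab_group_add" +
  assumes rank_one: "has_rank (const_val v) 1"
begin

definition G1 :: "'g set" where "G1 = value_group (const_val v)"

lemma const_val_eq: "const_val v a = u [:a:]"
  by (simp add: const_val_def poly_val_def)

lemma G1I: "a \<noteq> 0 \<Longrightarrow> u [:a:] \<in> G1"
  by (auto simp: G1_def value_group_def const_val_eq)

lemma G1_0: "0 \<in> G1"
  using G1I [of 1] by (simp flip: one_pCons)

lemma G1_diff: "g \<in> G1 \<Longrightarrow> h \<in> G1 \<Longrightarrow> g - h \<in> G1"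
proof -
  assume "g \<in> G1" "h \<in> G1"
  then obtain a c where ac: "a \<noteq> 0" "c \<noteq> 0" "g = u [:a:]" "h = u [:c:]"
    by (auto simp: G1_def value_group_def const_val_eq)
  have "u [:a:] = u [:a / c:] + u [:c:]" using val_mult [of "[:a / c:]" "[:c:]"] ac by simp
  then show ?thesis using G1I [of "a / c"] ac by simp
qed

lemma G1_add: "g \<in> G1 \<Longrightarrow> h \<in> G1 \<Longrightarrow> g + h \<in> G1"
  using G1_diff [of g "0 - h"] G1_diff [of 0 h] G1_0 by simp

lemma G1_scale: "g \<in> G1 \<Longrightarrow> n \<cdot> g \<in> G1"
  by (induction n) (auto simp: G1_0 G1_add)

lemma isolated_zero: "isolated_subgroup {0} G1"
  by (auto simp: isolated_subgroup_def G1_0)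

lemma G1_pos: obtains h where "h \<in> G1" "0 < h"
proof -
  have "\<exists>h\<in>G1. h \<noteq> 0"
  proof (rule ccontr)
    assume "\<not> ?thesis"
    then have "G1 = {0}" using G1_0 by auto
    then have "{H. isolated_subgroup H G1 \<and> H \<noteq> G1} = {}"
      by (auto simp: isolated_subgroup_def)
    with rank_one show False by (simp add: has_rank_def flip: G1_def)
  qed
  then obtain h where "h \<in> G1" "h \<noteq> 0" by blast
  then show thesis using that [of h] that [of "- h"] G1_diff [OF G1_0, of h]
    by (cases "0 < h") auto
qed

text \<open>The elements bounded by multiples of \<open>h\<close> form an isolated subgroup other than \<open>{0}\<close>.\<close>

lemma archimedean_G1:
  assumes "g \<in> G1" "h \<in> G1" "0 < h"
  shows "\<exists>n. g \<le> n \<cdot> h"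
proof -
  define C where "C = {g \<in> G1. \<exists>n. g \<le> n \<cdot> h \<and> - g \<le> n \<cdot> h}"
  have "isolated_subgroup C G1"
    unfolding isolated_subgroup_def
  proof (intro conjI ballI impI)
    show "C \<subseteq> G1" by (auto simp: C_def)
    show "0 \<in> C" using G1_0 by (auto simp: C_def intro!: exI [of _ 0])
    show "a - c \<in> C" if ac: "a \<in> C" "c \<in> C" for a c
    proof -
      obtain n m where n: "a \<le> n \<cdot> h" "- a \<le> n \<cdot> h" and m: "c \<le> m \<cdot> h" "- c \<le> m \<cdot> h"
        using ac by (auto simp: C_def)
      have "a - c \<le> (n + m) \<cdot> h" using add_mono [OF n(1) m(2)] by (simp add: nat_scale_add)
      moreover have "- (a - c) \<le> (n + m) \<cdot> h"
        using add_mono [OF n(2) m(1)] by (simp add: nat_scale_add)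
      ultimately show ?thesis using ac by (auto simp: C_def G1_diff)
    qed
    show "c \<in> C" if "a \<in> C" "c \<in> G1" "0 \<le> c" "c \<le> a" for a c
    proof -
      from that(1) obtain n where n: "a \<le> n \<cdot> h" by (auto simp: C_def)
      have "0 \<le> n \<cdot> h" using assms(3) by (intro nat_scale_nonneg) simp
      then have "- c \<le> n \<cdot> h" using that(3) by (metis neg_le_0_iff_le order_trans)
      then show ?thesis using that n by (auto simp: C_def intro: order_trans)
    qed
  qed
  moreover have hC: "h \<in> C" "h \<noteq> 0"
    using assms(2,3) by (auto simp: C_def intro!: exI [of _ "1::nat"] intro: order_trans [of _ 0])
  moreover have "card {H. isolated_subgroup H G1 \<and> H \<noteq> G1} = 1"
    using rank_one by (simp add: has_rank_def G1_def)
  then obtain Z where Z: "{H. isolated_subgroup H G1 \<and> H \<noteq> G1} = {Z}" by (rule card_1_singletonE)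
  moreover have "{0} \<in> {H. isolated_subgroup H G1 \<and> H \<noteq> G1}"
    using isolated_zero hC assms(2) by auto
  ultimately have "C = G1" by auto
  then show ?thesis using assms(1) by (auto simp: C_def)
qed

text \<open>The value group of \<open>v\<close> may have larger rank than that of \<open>K\<close>. Archimedean arguments are possible
  nevertheless, since all values that occur before the last key polynomial lie in this subgroup
  (\<open>hull_key\<close>, \<open>hull_next\<close>).\<close>

definition divisible_hull :: "'g set" where "divisible_hull = {g. \<exists>n>0. n \<cdot> g \<in> G1}"

lemma G1_hull: "g \<in> G1 \<Longrightarrow> g \<in> divisible_hull"
  by (auto simp: divisible_hull_def intro!: exI [of _ 1])

lemma hull_diff: "g \<in> divisible_hull \<Longrightarrow> h \<in> divisible_hull \<Longrightarrow> g - h \<in> divisible_hull"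
proof -
  assume "g \<in> divisible_hull" "h \<in> divisible_hull"
  then obtain n m where nm: "n > 0" "m > 0" "n \<cdot> g \<in> G1" "m \<cdot> h \<in> G1" by (auto simp: divisible_hull_def)
  have "(n * m) \<cdot> (g - h) = (m * n) \<cdot> g - (n * m) \<cdot> h" by (simp add: nat_scale_diff mult.commute)
  also have "\<dots> = m \<cdot> n \<cdot> g - n \<cdot> m \<cdot> h" by (simp only: nat_scale_mult)
  also have "\<dots> \<in> G1" using nm by (simp add: G1_diff G1_scale)
  finally show ?thesis using nm by (auto simp: divisible_hull_def intro!: exI [of _ "n * m"])
qed

lemma hull_0: "0 \<in> divisible_hull" by (simp add: G1_hull G1_0)

lemma hull_add: "g \<in> divisible_hull \<Longrightarrow> h \<in> divisible_hull \<Longrightarrow> g + h \<in> divisible_hull"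
  using hull_diff [of g "0 - h"] hull_diff [of 0 h] hull_0 by simp

lemma hull_scale: "g \<in> divisible_hull \<Longrightarrow> n \<cdot> g \<in> divisible_hull"
  by (induction n) (auto simp: hull_0 hull_add)

lemma hull_root: "n \<cdot> g \<in> divisible_hull \<Longrightarrow> n > 0 \<Longrightarrow> g \<in> divisible_hull"
  unfolding divisible_hull_def by (auto simp flip: nat_scale_mult) (metis mult_pos_pos)

lemma archimedean_hull:
  assumes "g \<in> divisible_hull" "h \<in> divisible_hull" "0 < h"
  shows "\<exists>n. g \<le> n \<cdot> h"
proof (cases "0 \<le> g")
  case True
  obtain n m where nm: "n > 0" "m > 0" "n \<cdot> g \<in> G1" "m \<cdot> h \<in> G1"
    using assms by (auto simp: divisible_hull_def)
  have "0 < m \<cdot> h" using nat_scale_strict_mono [OF nm(2) assms(3)] by simp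
  then obtain k where "n \<cdot> g \<le> k \<cdot> m \<cdot> h" using archimedean_G1 nm by blast
  moreover have "g \<le> n \<cdot> g" using nat_scale_mono_left [of 1 n g] nm True by simp
  ultimately show ?thesis by (auto simp flip: nat_scale_mult intro: order_trans)
next
  case False
  then show ?thesis by (intro exI [of _ 0]) simp
qed

text \<open>A subset of the archimedean group \<open>divisible_hull\<close> has countable cofinality: it suffices to choose one
  element above each rational multiple of a fixed positive element that it reaches.\<close>

lemma countable_cofinal:
  assumes S: "S \<subseteq> divisible_hull" "S \<noteq> {}" and nomax: "\<And>s. s \<in> S \<Longrightarrow> \<exists>s'\<in>S. s < s'"
  shows "\<exists>t :: nat \<Rightarrow> 'g. (\<forall>i. t i \<in> S) \<and> (\<forall>s\<in>S. \<exists>i. s < t i)"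
proof -
  obtain h where h: "h \<in> G1" "0 < h" by (rule G1_pos)
  from S(2) obtain b where b: "b \<in> S" by blast
  define P where "P i s \<longleftrightarrow> (case prod_decode i of (n, k) \<Rightarrow> k \<cdot> h \<le> n \<cdot> (s - b))" for i s
  define t where "t i = (if \<exists>s\<in>S. P i s then SOME s. s \<in> S \<and> P i s else b)" for i
  have t: "t i \<in> S \<and> P i (t i)" if "\<exists>s\<in>S. P i s" for i
    using someI_ex [of "\<lambda>s. s \<in> S \<and> P i s"] that by (auto simp: t_def)
  have "t i \<in> S" for i using t b by (cases "\<exists>s\<in>S. P i s") (auto simp: t_def)
  moreover have "\<exists>i. s < t i" if s: "s \<in> S" for s
  proof -
    define r where "r = max s b"
    have r: "r \<in> S" "s \<le> r" "b \<le> r" using s b by (auto simp: r_def max_def)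
    obtain s' where s': "s' \<in> S" "r < s'" using nomax [OF r(1)] by blast
    have "s' - r \<in> divisible_hull" "0 < s' - r" using S r s' by (auto intro: hull_diff)
    then obtain n where n: "h \<le> n \<cdot> (s' - r)" using archimedean_hull G1_hull h by blast
    have "n \<cdot> (r - b) \<in> divisible_hull" using S r b by (intro hull_scale hull_diff) auto
    then obtain m where "n \<cdot> (r - b) \<le> m \<cdot> h" using archimedean_hull G1_hull h by blast
    also have "m \<cdot> h < Suc m \<cdot> h" using h by simp
    finally have m: "n \<cdot> (r - b) < Suc m \<cdot> h" .
    define k where "k = (LEAST k. n \<cdot> (r - b) < k \<cdot> h)"
    have k: "n \<cdot> (r - b) < k \<cdot> h" unfolding k_def using m by (rule LeastI)
    have "0 \<le> n \<cdot> (r - b)" using r by (intro nat_scale_nonneg) simp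
    with k have "k \<noteq> 0" by (intro notI) simp
    then obtain k' where k': "k = Suc k'" using not0_implies_Suc by blast
    then have "k' < (LEAST k. n \<cdot> (r - b) < k \<cdot> h)" by (simp add: k_def)
    then have "k' \<cdot> h \<le> n \<cdot> (r - b)" using not_less_Least by (meson not_less)
    then have "k \<cdot> h \<le> n \<cdot> (s' - r) + n \<cdot> (r - b)" unfolding k' by (auto intro: add_mono n)
    also have "\<dots> = n \<cdot> (s' - b)" by (simp flip: nat_scale_plus)
    finally have "P (prod_encode (n, k)) s'" by (simp add: P_def)
    then have "P (prod_encode (n, k)) (t (prod_encode (n, k)))" using t s' by blast
    then have "k \<cdot> h \<le> n \<cdot> (t (prod_encode (n, k)) - b)" by (simp add: P_def)
    with k have "n \<cdot> (r - b) < n \<cdot> (t (prod_encode (n, k)) - b)" by simp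
    then have "r < t (prod_encode (n, k))"
      by (metis diff_right_mono nat_scale_mono not_less)
    then show ?thesis using r(2) by (blast intro: order_le_less_trans)
  qed
  ultimately show ?thesis by blast
qed

definition hull_below :: "'k poly \<Rightarrow> bool" where
  "hull_below Q \<longleftrightarrow> (\<forall>a. a \<noteq> 0 \<longrightarrow> degree a < degree Q \<longrightarrow> u a \<in> divisible_hull)"

text \<open>If the value of some polynomial exceeds its truncation, then two terms of its expansion have the
  same value, so that a multiple of the value of \<open>Q\<close> is a difference of values of coefficients.\<close>

lemma hull_key:
  assumes Q: "0 < degree Q" "hull_below Q" and f: "f \<noteq> 0" "unstable Q f"
  shows "u Q \<in> divisible_hull"
proof -
  let ?c = "adic_coeff Q f" and ?\<beta> = "u Q"
  have Q0: "Q \<noteq> 0" using Q(1) by auto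
  have h: "0 < u f - truncation v Q f" using f by simp
  obtain e \<delta> \<kappa> where lead: "lead_at Q ?\<beta> e \<delta> \<kappa> f" using lead_at_exists [OF Q(1) f(1) h] by metis
  have tr: "truncation v Q f = \<kappa> + \<delta> \<cdot> ?\<beta>" using truncation_lead_at [OF lead Q(1)] .
  have c\<delta>: "?c \<delta> \<noteq> 0" "u (?c \<delta>) = \<kappa>" using lead by (auto simp: lead_at_def)
  have "\<exists>k. k \<noteq> \<delta> \<and> ?c k \<noteq> 0 \<and> k \<cdot> ?\<beta> + u (?c k) = \<kappa> + \<delta> \<cdot> ?\<beta>"
  proof (rule ccontr)
    assume no: "\<not> ?thesis"
    have "vgt (\<kappa> + \<delta> \<cdot> ?\<beta>) (?c k * Q ^ k)" if "k \<noteq> \<delta>" for k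
    proof (cases "?c k = 0")
      case False
      then have "\<kappa> + \<delta> \<cdot> ?\<beta> < k \<cdot> ?\<beta> + u (?c k)"
        using no that truncation_le_term [OF Q(1) False] tr by (metis order.not_eq_order_implies_strict)
      then show ?thesis using False Q0 by (simp add: vgt_def val_mult val_power add.commute)
    qed simp
    then have "vgt (\<kappa> + \<delta> \<cdot> ?\<beta>) (\<Sum>k\<in>{..degree f} - {\<delta>}. ?c k * Q ^ k)" by (intro vgt_sum) auto
    moreover have "\<delta> \<in> {..degree f}" using adic_expansion(2) [OF Q(1)] c\<delta>(1) by (auto simp: not_less [symmetric])
    then have "(\<Sum>k\<le>degree f. ?c k * Q ^ k) = ?c \<delta> * Q ^ \<delta> + (\<Sum>k\<in>{..degree f} - {\<delta>}. ?c k * Q ^ k)"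
      by (intro sum.remove) auto
    then have "?c \<delta> * Q ^ \<delta> - f = - (\<Sum>k\<in>{..degree f} - {\<delta>}. ?c k * Q ^ k)"
      unfolding adic_expansion(1) [OF Q(1), of f, symmetric] by (metis diff_add_cancel minus_diff_eq add_diff_cancel_left')
    moreover have "u (?c \<delta> * Q ^ \<delta>) = \<kappa> + \<delta> \<cdot> ?\<beta>" using c\<delta> Q0 by (simp add: val_mult val_power)
    ultimately have "vgt (u (?c \<delta> * Q ^ \<delta>)) (?c \<delta> * Q ^ \<delta> - f)"
      by (simp only: vgt_minus)
    from val_close(2) [OF _ this] c\<delta> Q0 have "u f = \<kappa> + \<delta> \<cdot> ?\<beta>" by (simp add: val_mult val_power)
    then show False using f tr by simp
  qed
  then obtain k where k: "k \<noteq> \<delta>" "?c k \<noteq> 0" "k \<cdot> ?\<beta> + u (?c k) = \<delta> \<cdot> ?\<beta> + \<kappa>"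
    by (auto simp: add.commute)
  have uc: "u (?c j) \<in> divisible_hull" if "?c j \<noteq> 0" for j
    using Q that degree_adic_coeff [OF Q(1)] by (auto simp: hull_below_def)
  show ?thesis
  proof (cases "k < \<delta>")
    case True
    then obtain n where n: "\<delta> = k + n" "n > 0" using less_imp_add_positive by blast
    then have "n \<cdot> ?\<beta> = u (?c k) - \<kappa>" using k(3) by (simp add: nat_scale_add algebra_simps)
    then show ?thesis using hull_root [of n] n uc k c\<delta> hull_diff by metis
  next
    case False
    with k(1) have "\<delta> < k" by simp
    then obtain n where n: "k = \<delta> + n" "n > 0" using less_imp_add_positive by blast
    then have "n \<cdot> ?\<beta> = \<kappa> - u (?c k)" using k(3) by (simp add: nat_scale_add algebra_simps)
    then show ?thesis using hull_root [of n] n uc k c\<delta> hull_diff by metis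
  qed
qed

lemma hull_next:
  assumes "key Q \<tau>" "hull_below Q" "least_degree_monic (unstable Q) R"
  shows "hull_below R"
  unfolding hull_below_def
proof (intro allI impI)
  note d = keyD [OF assms(1)]
  fix a :: "'k poly" assume a: "a \<noteq> 0" "degree a < degree R"
  have "R \<noteq> 0" "unstable Q R" using assms(3) by (auto simp: least_degree_monic_def)
  then have uQ: "u Q \<in> divisible_hull" using hull_key [OF d(2) assms(2)] by blast
  obtain e \<delta> \<kappa> where lead: "lead_at Q (u Q) e \<delta> \<kappa> a"
    using lead_at_exists [OF d(2) a(1)] d(3) by (metis diff_gt_0_iff_gt)
  then have "u a = \<kappa> + \<delta> \<cdot> u Q"
    using truncation_lead_at [OF _ d(2)] least_stable [OF assms(1,3) a] by metis
  moreover have "\<kappa> \<in> divisible_hull"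
    using lead assms(2) degree_adic_coeff [OF d(2)] by (auto simp: lead_at_def hull_below_def)
  ultimately show "u a \<in> divisible_hull" using uQ by (auto intro: hull_add hull_scale)
qed

end

locale rank_one_char_0_valuation = rank_one_valuation v
  for v :: "'k::field poly fract \<Rightarrow> 'g::linordered_ab_group_add" +
  assumes char_0: "has_char_0 (residue_field (const_val v))"
begin

lemma valuation_ring_ideal:
  fixes R (structure)
  defines "R \<equiv> valuation_ring (const_val v)"
  shows "ideal (valuation_ideal (const_val v)) R" "cring R"
proof -
  have c: "a \<in> carrier R \<longleftrightarrow> vge 0 [:a:]" for a
    by (auto simp: R_def valuation_ring_def vge_def const_val_eq)
  have i: "a \<in> valuation_ideal (const_val v) \<longleftrightarrow> vgt 0 [:a:]" for a
    by (auto simp: valuation_ideal_def vgt_def const_val_eq)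
  have [simp]: "a \<otimes>\<^bsub>R\<^esub> b = a * b" "a \<oplus>\<^bsub>R\<^esub> b = a + b" "\<one>\<^bsub>R\<^esub> = 1" "\<zero>\<^bsub>R\<^esub> = 0" for a b
    by (simp_all add: R_def valuation_ring_def)
  have add: "vge 0 [:a + b:]" if "vge 0 [:a:]" "vge 0 [:b:]" for a b
    using vge_add [OF that] by simp
  have mult: "vge 0 [:a * b:]" if "vge 0 [:a:]" "vge 0 [:b:]" for a b
    using vge_mult [OF that] by (simp add: mult.commute)
  have multi: "vgt 0 [:a * b:]" if "vge 0 [:a:]" "vgt 0 [:b:]" for a b
    using that val_mult [of "[:a:]" "[:b:]"] unfolding vge_def vgt_def
    by (cases "a = 0"; cases "b = 0") (simp_all add: add_nonneg_pos mult.commute)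
  have one: "vge 0 [:1:]" by (simp add: vge_def flip: one_pCons)
  show "cring R"
  proof (rule cringI)
    show "abelian_group R"
    proof (rule abelian_groupI)
      show "\<exists>y\<in>carrier R. y \<oplus>\<^bsub>R\<^esub> x = \<zero>\<^bsub>R\<^esub>" if "x \<in> carrier R" for x
        using that vge_minus [of 0 "[:x:]"] by (intro bexI [of _ "- x"]) (auto simp: c)
    qed (auto simp: c add algebra_simps)
    show "comm_monoid R" by (rule comm_monoidI) (auto simp: c one ac_simps intro: mult)
  qed (auto simp: algebra_simps)
  then interpret cring R .
  show "ideal (valuation_ideal (const_val v)) R"
  proof (rule idealI)
    show "ring R" by (rule ring_axioms)
    show "subgroup (valuation_ideal (const_val v)) (add_monoid R)"
    proof (rule add.subgroupI)
      show "valuation_ideal (const_val v) \<subseteq> carrier R" by (auto simp: c i vgt_imp_vge)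
      show "valuation_ideal (const_val v) \<noteq> {}" using i [of 0] by auto
      fix a b assume ab: "a \<in> valuation_ideal (const_val v)"
      then have "\<ominus>\<^bsub>R\<^esub> a = - a"
        using vgt_imp_vge vge_minus [of 0 "[:a:]"] by (intro minus_equality) (auto simp: c i)
      then show "\<ominus>\<^bsub>R\<^esub> a \<in> valuation_ideal (const_val v)"
        using ab vgt_minus [of 0 "[:a:]"] by (simp add: i)
      assume "b \<in> valuation_ideal (const_val v)"
      then show "a \<oplus>\<^bsub>R\<^esub> b \<in> valuation_ideal (const_val v)"
        using ab vgt_add [of 0 "[:a:]" "[:b:]"] by (simp add: i)
    qed
  next
    fix a x assume "a \<in> valuation_ideal (const_val v)" "x \<in> carrier R"
    then have "vgt 0 [:x * a:]" using multi c i by blast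
    then show "x \<otimes>\<^bsub>R\<^esub> a \<in> valuation_ideal (const_val v)"
      "a \<otimes>\<^bsub>R\<^esub> x \<in> valuation_ideal (const_val v)"
      by (simp_all add: i mult.commute)
  qed
qed

text \<open>In the residue field, \<open>n\<close> times \<open>1\<close> is the class of \<open>n\<close>. As it does not vanish, \<open>n\<close> is a unit of the
  valuation ring.\<close>

lemma val_of_nat:
  assumes "n > 0"
  shows "(of_nat n :: 'k) \<noteq> 0" "u [:of_nat n:] = 0"
proof -
  define R where "R = valuation_ring (const_val v)"
  define I where "I = valuation_ideal (const_val v)"
  interpret R: cring R using valuation_ring_ideal by (simp add: R_def)
  interpret ideal I R using valuation_ring_ideal by (simp add: R_def I_def)
  have [simp]: "a \<oplus>\<^bsub>R\<^esub> b = a + b" "\<one>\<^bsub>R\<^esub> = 1" "\<zero>\<^bsub>R\<^esub> = 0" for a b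
    by (simp_all add: R_def valuation_ring_def)
  interpret h: ring_hom_ring R "R Quot I" "(+>\<^bsub>R\<^esub>) I" by (rule rcos_ring_hom_ring)
  have nat: "of_nat m \<in> carrier R \<and> [m] \<cdot>\<^bsub>R Quot I\<^esub> \<one>\<^bsub>R Quot I\<^esub> = I +>\<^bsub>R\<^esub> of_nat m" for m
  proof (induction m)
    case 0
    then show ?case using h.hom_zero by (simp add: R.zero_closed [simplified])
  next
    case (Suc m)
    have 1: "(1::'k) \<in> carrier R" using R.one_closed by simp
    have "of_nat m + 1 \<in> carrier R" using R.a_closed [of "of_nat m" 1] Suc 1 by simp
    moreover have "[Suc m] \<cdot>\<^bsub>R Quot I\<^esub> \<one>\<^bsub>R Quot I\<^esub> = (I +>\<^bsub>R\<^esub> of_nat m) \<oplus>\<^bsub>R Quot I\<^esub> (I +>\<^bsub>R\<^esub> 1)"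
      using Suc h.hom_one h.S.add.nat_pow_Suc by simp
    moreover have "\<dots> = I +>\<^bsub>R\<^esub> (of_nat m + 1)"
      using h.hom_add [of "of_nat m" 1] Suc 1 by simp
    ultimately show ?case by (simp add: add.commute)
  qed
  have "of_nat n \<notin> I"
  proof
    assume "of_nat n \<in> I"
    then have "I +>\<^bsub>R\<^esub> of_nat n = I" using nat by (intro R.a_coset_join2 a_subgroup) auto
    then have "[n] \<cdot>\<^bsub>R Quot I\<^esub> \<one>\<^bsub>R Quot I\<^esub> = \<zero>\<^bsub>R Quot I\<^esub>" using nat by (simp add: FactRing_def)
    then show False using char_0 assms by (auto simp: has_char_0_def residue_field_def R_def I_def)
  qed
  then show "(of_nat n :: 'k) \<noteq> 0" "u [:of_nat n:] = 0"
    using nat [of n] by (auto simp: I_def R_def valuation_ideal_def valuation_ring_def const_val_eq)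
qed


section \<open>Expansions with respect to two polynomials of the same degree\<close>

lemma filt_of_nat: "filt Q b e m \<gamma> f \<Longrightarrow> filt Q b e m \<gamma> (of_nat n * f)"
  by (induction n) (auto simp: algebra_simps intro: filt_add)

context
  fixes Q R z :: "'k poly" and \<tau> e \<beta> :: 'g
  assumes key: "key R \<tau>" and e: "\<tau> + e \<le> \<beta>" "0 \<le> e"
    and z: "degree z < degree R" "vge \<beta> z" and Q: "Q = R - z"
begin

private lemmas mult = filt_mult [OF key e]

lemma filt_small:
  assumes "degree a < degree R" "vge \<gamma> a"
  shows "filt R \<beta> e (Suc 0) \<gamma> a"
proof -
  have "filt R \<beta> e (Suc 0) \<gamma> (a * R ^ 0)" using assms by (intro filt_term) (auto simp: vge_def)
  then show ?thesis by simp
qed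

lemma filt_key_power: "filt R \<beta> e (Suc n) (n \<cdot> \<beta>) (R ^ n)"
proof -
  have "filt R \<beta> e (Suc n) (n \<cdot> \<beta>) (1 * R ^ n)" using keyD [OF key] by (intro filt_term) auto
  then show ?thesis by simp
qed

lemma filt_other: "filt R \<beta> e (Suc 1) \<beta> Q"
proof -
  have "filt R \<beta> e (Suc 1) \<beta> R" using filt_key_power [of 1] by simp
  then show ?thesis unfolding Q using filt_mono [OF filt_small [OF z]] by (intro filt_diff) auto
qed

lemma filt_other_power: "filt R \<beta> e (Suc n) (n \<cdot> \<beta>) (Q ^ n)"
proof (induction n)
  case 0
  show ?case using filt_key_power [of 0] by simp
next
  case (Suc n)
  show ?case using mult [OF filt_other Suc] by simp
qed

text \<open>The binomial expansion of \<open>(R - z) ^ Suc m\<close> up to its second term. The factor \<open>Suc m\<close> is the one by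
  which a Newton step divides. Later terms involve at least two factors \<open>z\<close> and only powers of \<open>R\<close>
  below \<open>R ^ m\<close>; reducing their coefficients modulo \<open>R\<close> produces only negligible carries.\<close>

lemma filt_binomial:
  "filt R \<beta> e m (Suc m \<cdot> \<beta>) (Q ^ Suc m - R ^ Suc m + of_nat (Suc m) * (z * R ^ m))"
proof (induction m)
  case 0
  show ?case by (simp add: Q)
next
  case (Suc m)
  let ?T = "\<lambda>m. Q ^ Suc m - R ^ Suc m + of_nat (Suc m) * (z * R ^ m)"
  have z1: "filt R \<beta> e (Suc 0) \<beta> z" by (rule filt_small [OF z])
  have "filt R \<beta> e (m + 1) (Suc m \<cdot> \<beta> + \<beta>) (?T m * Q)"
    by (rule mult [OF Suc filt_other])
  moreover have "filt R \<beta> e (Suc m + 0) (m \<cdot> \<beta> + (\<beta> + \<beta>)) (R ^ m * (z * z))"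
    using mult [OF z1 z1] by (intro mult filt_key_power) simp
  then have "filt R \<beta> e (Suc m) (Suc (Suc m) \<cdot> \<beta>) (of_nat (Suc m) * (R ^ m * (z * z)))"
    by (intro filt_of_nat) (simp add: ac_simps)
  ultimately have "filt R \<beta> e (Suc m) (Suc (Suc m) \<cdot> \<beta>) (?T m * Q + of_nat (Suc m) * (R ^ m * (z * z)))"
    by (intro filt_add) (simp_all add: ac_simps)
  moreover have "?T m * Q + of_nat (Suc m) * (R ^ m * (z * z)) = ?T (Suc m)"
    unfolding Q by (simp add: algebra_simps)
  ultimately show ?case by simp
qed

lemma filt_power_diff: "filt R \<beta> e m (m \<cdot> \<beta>) (Q ^ m - R ^ m)"
proof (cases m)
  case (Suc n)
  have "filt R \<beta> e m (m \<cdot> \<beta>) (R ^ n * z)"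
    using mult [OF filt_key_power filt_small [OF z], of n] Suc by (simp add: add.commute)
  then have "filt R \<beta> e m (m \<cdot> \<beta>) (of_nat (Suc n) * (R ^ n * z))" by (rule filt_of_nat)
  with filt_mono [OF filt_binomial [of n], of m]
  have "filt R \<beta> e m (m \<cdot> \<beta>) ((Q ^ m - R ^ m + of_nat (Suc n) * (z * R ^ n)) - of_nat (Suc n) * (R ^ n * z))"
    unfolding Suc by (intro filt_diff) auto
  then show ?thesis by (simp add: mult.commute)
qed simp

lemma same_degree: "degree Q = degree R"
proof -
  have "degree (- z + R) = degree R" using z(1) by (intro degree_add_eq_right) simp
  then show ?thesis unfolding Q by (simp only: diff_conv_add_uminus add.commute)
qed

text \<open>If the terms of the \<open>Q\<close>-expansion beyond index \<open>Suc m\<close> are negligible, then so are those of the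
  \<open>R\<close>-expansion; the leading coefficient survives, and the one before it changes as in the
  substitution \<open>Q = R - z\<close>.\<close>

lemma re_expansion:
  assumes f: "filt Q \<beta> e (Suc (Suc m)) \<gamma> f"
  defines "c \<equiv> adic_coeff Q f"
  defines "r \<equiv> (c (Suc m) * z) mod R"
  shows "filt R \<beta> e m \<gamma> (f - c (Suc m) * R ^ Suc m - (c m - of_nat (Suc m) * r) * R ^ m)"
proof -
  note d = keyD [OF key]
  have dQ: "0 < degree Q" using same_degree d(2) by simp
  have cdeg: "degree (c j) < degree R" for j
    unfolding c_def same_degree [symmetric] by (rule degree_adic_coeff [OF dQ])
  have c: "vge (\<gamma> - j \<cdot> \<beta>) (c j)" "Suc (Suc m) \<le> j \<Longrightarrow> vge (\<gamma> + e - j \<cdot> \<beta>) (c j)" for j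
    using f by (auto simp: filt_def c_def)
  note c1 = filt_small [OF cdeg c(1)] and c2 = filt_small [OF cdeg c(2)]
  define h where "h = (c (Suc m) * z) div R"
  have rh: "c (Suc m) * z = r + h * R" by (simp add: r_def h_def)
  define n where "n = degree f + m + 3"
  define T where "T = Q ^ Suc m - R ^ Suc m + of_nat (Suc m) * (z * R ^ m)"
  have trm: "filt R \<beta> e m \<gamma> (c j * Q ^ j)" if "j \<noteq> m" "j \<noteq> Suc m" for j
  proof (cases "j < m")
    case True
    have "filt R \<beta> e (Suc 0 + j) (\<gamma> - j \<cdot> \<beta> + j \<cdot> \<beta>) (c j * Q ^ j)"
      by (rule mult [OF c1 filt_other_power])
    then show ?thesis using filt_mono True by fastforce
  next
    case False
    then have "filt R \<beta> e (Suc 0 + j) (\<gamma> + e - j \<cdot> \<beta> + j \<cdot> \<beta>) (c j * Q ^ j)"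
      using that by (intro mult [OF c2 filt_other_power]) auto
    then show ?thesis using filt_shift e(2) by fastforce
  qed
  have 1: "filt R \<beta> e m \<gamma> (\<Sum>j\<in>{..<n} - {m, Suc m}. c j * Q ^ j)"
    by (intro filt_sum trm) auto
  have 2: "filt R \<beta> e m \<gamma> ((Q ^ m - R ^ m) * c m)"
    using mult [OF filt_power_diff c1, of m m] by simp
  have 3: "filt R \<beta> e m \<gamma> (T * c (Suc m))"
    using mult [OF filt_binomial c1, of m "Suc m"] by (simp add: T_def algebra_simps)
  have 4: "filt R \<beta> e m \<gamma> (of_nat (Suc m) * (h * R ^ Suc m))"
  proof (cases "c (Suc m) = 0 \<or> z = 0")
    case True
    then have "h = 0" by (auto simp: h_def)
    then show ?thesis by simp
  next
    case False
    then have cz: "c (Suc m) \<noteq> 0" "z \<noteq> 0" by auto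
    obtain h' where h': "h = h'" "degree h' < degree R"
        "h' \<noteq> 0 \<Longrightarrow> u (c (Suc m)) + u z \<le> \<tau> + u h'"
    proof (rule key_mult [OF key cz cdeg z(1)])
      fix r' h' assume "c (Suc m) * z = r' + h' * R" "degree r' < degree R" "degree h' < degree R"
        "h' \<noteq> 0 \<Longrightarrow> u (c (Suc m)) + u z \<le> \<tau> + u h'"
      moreover from this have "h = h'" unfolding h_def using d(4) by (simp add: div_poly_less)
      ultimately show thesis using that by blast
    qed
    have "filt R \<beta> e m \<gamma> (h * R ^ Suc m)"
    proof (cases "h = 0")
      case False
      have i: "\<gamma> \<le> Suc m \<cdot> \<beta> + u (c (Suc m))"
        using c(1) [of "Suc m"] cz by (simp add: vge_def diff_le_eq ac_simps)
      have ii: "\<beta> \<le> u z" using z cz by (simp add: vge_def)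
      have iii: "u (c (Suc m)) + u z \<le> \<tau> + u h" using h' False by simp
      have *: "\<gamma> + e \<le> Suc m \<cdot> \<beta> + u h"
        using add_mono [OF add_mono [OF add_mono [OF i ii] iii] e(1)] by (simp add: algebra_simps)
      have "\<gamma> \<le> \<gamma> + e" using e by simp
      also note *
      finally show ?thesis using h' * by (intro filt_term) auto
    qed simp
    then show ?thesis by (rule filt_of_nat)
  qed
  have "f = (\<Sum>j<n. c j * Q ^ j)" unfolding c_def by (rule adic_expansion_lessThan [OF dQ]) (simp add: n_def)
  also have "\<dots> = c m * Q ^ m + (\<Sum>j\<in>{..<n} - {m}. c j * Q ^ j)"
    by (rule sum.remove) (auto simp: n_def)
  also have "(\<Sum>j\<in>{..<n} - {m}. c j * Q ^ j) = c (Suc m) * Q ^ Suc m + (\<Sum>j\<in>{..<n} - {m} - {Suc m}. c j * Q ^ j)"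
    by (rule sum.remove) (auto simp: n_def)
  also have "{..<n} - {m} - {Suc m} = {..<n} - {m, Suc m}" by auto
  finally have f_eq: "f = c m * Q ^ m + (c (Suc m) * Q ^ Suc m + (\<Sum>j\<in>{..<n} - {m, Suc m}. c j * Q ^ j))" .
  have czR: "c (Suc m) * (z * R ^ m) = r * R ^ m + h * R ^ Suc m"
  proof -
    have "c (Suc m) * (z * R ^ m) = (c (Suc m) * z) * R ^ m" by (simp add: ac_simps)
    then show ?thesis unfolding rh by (simp add: algebra_simps)
  qed
  have "T * c (Suc m) = c (Suc m) * Q ^ Suc m - c (Suc m) * R ^ Suc m
      + of_nat (Suc m) * (c (Suc m) * (z * R ^ m))"
    unfolding T_def by (simp add: algebra_simps del: of_nat_Suc)
  then have "T * c (Suc m) = c (Suc m) * Q ^ Suc m - c (Suc m) * R ^ Suc m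
      + of_nat (Suc m) * (r * R ^ m) + of_nat (Suc m) * (h * R ^ Suc m)"
    unfolding czR by (simp only: distrib_left add.assoc)
  then have "f - c (Suc m) * R ^ Suc m - (c m - of_nat (Suc m) * r) * R ^ m
    = (\<Sum>j\<in>{..<n} - {m, Suc m}. c j * Q ^ j) + (Q ^ m - R ^ m) * c m + T * c (Suc m)
      - of_nat (Suc m) * (h * R ^ Suc m)"
    by (subst f_eq) (simp add: algebra_simps del: of_nat_Suc)
  also have "filt R \<beta> e m \<gamma> \<dots>" by (intro filt_add filt_diff 1 2 3 4)
  finally show ?thesis .
qed

lemma re_expansion_coeffs:
  assumes f: "filt Q \<beta> e (Suc (Suc m)) \<gamma> f"
  shows "Suc m < k \<Longrightarrow> vge (\<gamma> + e - k \<cdot> \<beta>) (adic_coeff R f k)"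
    and "vge (\<gamma> + e - Suc m \<cdot> \<beta>) (adic_coeff R f (Suc m) - adic_coeff Q f (Suc m))"
    and "vge (\<gamma> + e - m \<cdot> \<beta>) (adic_coeff R f m - (adic_coeff Q f m
           - of_nat (Suc m) * ((adic_coeff Q f (Suc m) * z) mod R)))"
proof -
  note d = keyD [OF key]
  have dQ: "0 < degree Q" using same_degree d(2) by simp
  let ?c = "adic_coeff Q f"
  let ?r = "(?c (Suc m) * z) mod R"
  have 1: "degree (?c j) < degree R" for j
    unfolding same_degree [symmetric] by (rule degree_adic_coeff [OF dQ])
  have "degree (of_nat (Suc m) * ?r) \<le> degree ?r"
    using degree_mult_le [of "of_nat (Suc m)" ?r] by (simp del: of_nat_Suc)
  also have "\<dots> < degree R" using degree_mod_less [OF d(4), of "?c (Suc m) * z"] d(2) by auto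
  finally have 2: "degree (?c m - of_nat (Suc m) * ?r) < degree R" by (intro degree_diff_less 1)
  have *: "vge (\<gamma> + e - k \<cdot> \<beta>) (adic_coeff R f k - (if k = Suc m then ?c (Suc m) else 0)
      - (if k = m then ?c m - of_nat (Suc m) * ?r else 0))" if "m \<le> k" for k
    using re_expansion [OF f] that
    unfolding filt_def adic_coeff_diff adic_coeff_term [OF 1] adic_coeff_term [OF 2] by blast
  show "Suc m < k \<Longrightarrow> vge (\<gamma> + e - k \<cdot> \<beta>) (adic_coeff R f k)" using * [of k] by simp
  show "vge (\<gamma> + e - Suc m \<cdot> \<beta>) (adic_coeff R f (Suc m) - ?c (Suc m))"
    using * [of "Suc m"] by simp
  show "vge (\<gamma> + e - m \<cdot> \<beta>) (adic_coeff R f m - (?c m - of_nat (Suc m) * ?r))"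
    using * [of m] by simp
qed

end

end

context rank_one_char_0_valuation
begin

section \<open>Newton steps\<close>

lemma val_of_nat_poly:
  assumes "n > 0"
  shows "(of_nat n :: 'k poly) \<noteq> 0" "u (of_nat n) = 0"
  using val_of_nat [OF assms] assms by (auto simp: of_nat_poly)

lemma plateau_key:
  assumes "key P \<tau>" "lead_coeff Q = 1" "degree Q = degree P" "u P < u Q"
  shows "key Q (u P)"
  using key_next(1) [OF assms(1) same_degree_next(1) [OF assms]] same_degree_next(3) [OF assms] by simp

text \<open>One Newton step.  Suppose that \<open>Suc m\<close> is the last dominant index at \<open>Q\<close> and that for every
  better approximation \<open>R\<close> of the same degree the term of index \<open>m\<close> is bounded below by the term of
  index \<open>Suc m\<close>. In residue characteristic \<open>0\<close> the division of the coefficient at \<open>m\<close> by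
  \<open>Suc m\<close> times the leading one does not change values, and its result \<open>z\<close> approximates
  every difference \<open>R - Q\<close> as well as possible, up to the precision \<open>e\<close> of the expansion.\<close>

lemma newton_step:
  fixes Q f :: "'k poly"
  assumes Q: "key Q \<tau>" "\<tau> + e \<le> u Q" "0 < e" and lead: "lead_at Q (u Q) e (Suc m) \<kappa> f"
  obtains z where "degree z < degree Q"
    "\<And>R. key R \<tau> \<Longrightarrow> degree R = degree Q \<Longrightarrow> u Q < u R \<Longrightarrow> vge (\<kappa> + u R) (adic_coeff R f m) \<Longrightarrow>
       vge (min (u R) (u Q + e)) (Q + z)"
proof -
  note d = keyD [OF Q(1)]
  let ?\<beta> = "u Q" and ?c = "adic_coeff Q f" and ?n = "of_nat (Suc m) :: 'k poly"
  let ?D = "?c (Suc m)"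
  have D: "?D \<noteq> 0" "u ?D = \<kappa>" and filt: "filt Q ?\<beta> e (Suc (Suc m)) (\<kappa> + Suc m \<cdot> ?\<beta>) f"
    using lead by (auto simp: lead_at_def)
  have cdeg: "degree (?c j) < degree Q" for j by (rule degree_adic_coeff [OF d(2)])
  have cm: "vge (\<kappa> + ?\<beta>) (?c m)"
  proof -
    have "vge (\<kappa> + Suc m \<cdot> ?\<beta> - m \<cdot> ?\<beta>) (?c m)" using filt unfolding filt_def by blast
    then show ?thesis by (simp add: algebra_simps)
  qed
  have n: "?n \<noteq> 0" "u ?n = 0" using val_of_nat_poly [of "Suc m"] by auto
  have n': "(of_nat (Suc m) :: 'k) \<noteq> 0" using val_of_nat [of "Suc m"] by simp
  obtain a where a: "a \<noteq> 0" "degree a < degree Q" "(a * ?D) mod Q = 1"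
    using key_inverse [OF Q(1) D(1) cdeg] by blast
  obtain h where h: "a * ?D = 1 + h * Q" "u a + \<kappa> = 0" "h \<noteq> 0 \<Longrightarrow> 0 \<le> \<tau> + u h"
    using key_mult [OF Q(1) a(1) D(1) a(2) cdeg] a(3) D(2) val_1 by metis
  define s h1 where "s = (a * ?c m) mod Q" and "h1 = (a * ?c m) div Q"
  have sh: "a * ?c m = s + h1 * Q" by (simp add: s_def h1_def)
  have sdeg: "degree s < degree Q" using degree_mod_less [OF d(4), of "a * ?c m"] d(2) by (auto simp: s_def)
  have h1: "u a + u (?c m) \<le> \<tau> + u h1" if "h1 \<noteq> 0"
  proof -
    have "?c m \<noteq> 0" using that by (auto simp: h1_def)
    then show ?thesis using Q(1) a cdeg that unfolding key_def h1_def by blast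
  qed
  define z where "z = smult (inverse (of_nat (Suc m))) s"
  have nz: "?n * z = s" using n' unfolding z_def of_nat_poly by simp
  have zdeg: "degree z < degree Q" using sdeg by (simp add: z_def)
  have c_z: "vge (\<kappa> + ?\<beta> + e) (?c m - ?D * s)"
  proof -
    have 1: "vge e (h * Q)"
    proof (cases "h = 0")
      case False
      have "0 + (\<tau> + e) \<le> (\<tau> + u h) + ?\<beta>" by (rule add_mono [OF h(3) [OF False] Q(2)])
      then have "e \<le> u h + ?\<beta>" by (simp add: algebra_simps)
      then show ?thesis using False d(4) by (simp add: vge_def val_mult)
    qed simp
    have "?c m - ?D * s = ?D * h1 * Q - h * Q * ?c m"
    proof -
      have "?D * (a * ?c m) = ?D * s + ?D * h1 * Q" unfolding sh by (simp add: algebra_simps)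
      moreover have "?D * (a * ?c m) = ?c m + h * Q * ?c m"
      proof -
        have "?D * (a * ?c m) = (a * ?D) * ?c m" by (simp add: ac_simps)
        then show ?thesis unfolding h(1) by (simp add: algebra_simps)
      qed
      ultimately show ?thesis by (simp add: algebra_simps)
    qed
    moreover have "vge (\<kappa> + ?\<beta> + e) (h * Q * ?c m)"
      using vge_mult [OF 1 cm] by (simp add: ac_simps)
    moreover have "vge (\<kappa> + ?\<beta> + e) (?D * h1 * Q)"
    proof (cases "h1 = 0")
      case False
      then have "?c m \<noteq> 0" by (auto simp: h1_def)
      then have c: "\<kappa> + ?\<beta> \<le> u (?c m)" using cm by (simp add: vge_def)
      have "(\<kappa> + ?\<beta>) + (u a + u (?c m)) + (\<tau> + e) + \<kappa> \<le> u (?c m) + (\<tau> + u h1) + ?\<beta> + \<kappa>"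
        using add_mono [OF add_mono [OF c h1 [OF False]] Q(2)] by (rule add_right_mono)
      then have "(\<kappa> + ?\<beta>) + (u a + \<kappa>) + e \<le> \<kappa> + u h1 + ?\<beta>" by (simp add: algebra_simps)
      then show ?thesis using False D d(4) h(2) by (simp add: vge_def val_mult)
    qed simp
    ultimately show ?thesis using vge_diff by metis
  qed
  have "vge (min (u R) (?\<beta> + e)) (Q + z)"
    if R: "key R \<tau>" "degree R = degree Q" "u Q < u R" and Rm: "vge (\<kappa> + u R) (adic_coeff R f m)" for R
  proof -
    note dR = keyD [OF R(1)]
    let ?\<mu> = "min (u R) (?\<beta> + e)"
    define y where "y = R - Q"
    have y: "degree y < degree R" "vge ?\<beta> y"
      using monic_diff_degree [OF dR(1) d(1) R(2) d(2)] R(2,3) vge_diff [of ?\<beta> R Q]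
      by (auto simp: y_def vge_def less_imp_le)
    have Qy: "Q = R - y" by (simp add: y_def)
    define r where "r = (?D * y) mod R"
    have "vge (\<kappa> + Suc m \<cdot> ?\<beta> + e - m \<cdot> ?\<beta>) (adic_coeff R f m - (?c m - ?n * r))"
      using re_expansion_coeffs(3) [OF R(1) Q(2) less_imp_le [OF Q(3)] y Qy filt] by (simp only: r_def)
    then have 1: "vge (\<kappa> + ?\<beta> + e) (adic_coeff R f m - (?c m - ?n * r))"
      by (simp add: algebra_simps)
    have "\<kappa> + ?\<mu> \<le> \<kappa> + u R" "\<kappa> + ?\<mu> \<le> \<kappa> + ?\<beta> + e" by (simp_all add: add.assoc)
    note le = vge_mono [OF _ this(1)] vge_mono [OF _ this(2)]
    have 2: "vge (\<kappa> + ?\<beta> + e) (?D * y - r)"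
    proof -
      define g where "g = (?D * y) div R"
      have eq: "?D * y - r = g * R" by (simp add: r_def g_def minus_mod_eq_div_mult)
      show ?thesis
      proof (cases "g = 0")
        case False
        then have y0: "y \<noteq> 0" by (auto simp: g_def)
        have "degree ?D < degree R" using cdeg R(2) by simp
        then have "u ?D + u y \<le> \<tau> + u g" using R(1) D y y0 False unfolding key_def g_def by blast
        moreover have "?\<beta> \<le> u y" using y y0 by (simp add: vge_def)
        moreover have "\<tau> + e \<le> u R" using Q(2) R(3) by simp
        ultimately have "((\<kappa> + u y) + ?\<beta>) + (\<tau> + e) \<le> ((\<tau> + u g) + u y) + u R"
          unfolding D(2) by (intro add_mono [of _ _ "\<tau> + e"] add_mono [of _ _ ?\<beta>])
        then have "\<kappa> + ?\<beta> + e \<le> u g + u R" by (simp add: algebra_simps)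
        then show ?thesis unfolding eq using False dR(4) by (simp add: vge_def val_mult)
      qed (simp add: eq)
    qed
    have "vge (\<kappa> + ?\<mu>) (adic_coeff R f m - (adic_coeff R f m - (?c m - ?n * r)))"
      by (rule vge_diff [OF le(1) [OF Rm] le(2) [OF 1]])
    then have 3: "vge (\<kappa> + ?\<mu>) (?c m - ?n * r)" by simp
    have 4: "vge (\<kappa> + ?\<mu>) (?n * (?D * y - r))"
      using vge_mult [OF vge_self [of ?n] le(2) [OF 2]] n(2) by simp
    have "vge (\<kappa> + ?\<mu>) ((?c m - ?D * s) - ((?c m - ?n * r) - ?n * (?D * y - r)))"
      by (rule vge_diff [OF le(2) [OF c_z] vge_diff [OF 3 4]])
    also have "(?c m - ?D * s) - ((?c m - ?n * r) - ?n * (?D * y - r)) = ?n * ?D * (y - z)"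
      unfolding nz [symmetric] by (simp add: algebra_simps del: of_nat_Suc)
    finally have 5: "vge (\<kappa> + ?\<mu>) (?n * ?D * (y - z))" .
    have "vge ?\<mu> (y - z)"
    proof (cases "y - z = 0")
      case False
      then have "u (?n * ?D * (y - z)) = \<kappa> + u (y - z)" using n D
        by (metis add.left_neutral mult_eq_0_iff val_mult)
      then show ?thesis using 5 False n(1) D(1) by (simp add: vge_def del: of_nat_Suc min_le_iff_disj)
    qed simp
    moreover have "vge ?\<mu> R" by (simp add: vge_def)
    ultimately have "vge ?\<mu> (R - (y - z))" using vge_diff by blast
    then show ?thesis by (simp add: y_def)
  qed
  then show thesis using that zdeg by blast
qed

lemma lead_at_least:
  assumes "lead_at Q b e \<delta> \<kappa> f" "adic_coeff Q f k \<noteq> 0"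
  shows "\<kappa> + \<delta> \<cdot> b \<le> k \<cdot> b + u (adic_coeff Q f k)"
    and "\<delta> < k \<Longrightarrow> \<kappa> + \<delta> \<cdot> b + e \<le> k \<cdot> b + u (adic_coeff Q f k)"
  using assms unfolding lead_at_def filt_def vge_def by (auto simp: diff_le_eq ac_simps Suc_le_eq)

text \<open>A leading term at \<open>Q\<close> stays where it is at a better approximation \<open>R\<close>, unless the last
  dominant index drops.\<close>

lemma lead_at_same_degree:
  fixes Q R f :: "'k poly"
  assumes Q: "key Q \<tau>" "\<tau> + e \<le> u Q" "0 < e" and lead: "lead_at Q (u Q) e (Suc m) \<kappa> f"
    and R: "key R \<tau>" "degree R = degree Q" "u Q < u R"
    and lead': "lead_at R (u R) e' \<delta> \<kappa>' f" "Suc m \<le> \<delta>"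
  shows "lead_at R (u R) e (Suc m) \<kappa> f"
proof -
  note d = keyD [OF Q(1)] and dR = keyD [OF R(1)]
  let ?\<beta> = "u Q" and ?\<beta>' = "u R" and ?c = "adic_coeff Q f" and ?c' = "adic_coeff R f"
  have D: "?c (Suc m) \<noteq> 0" "u (?c (Suc m)) = \<kappa>"
    and filt: "filt Q ?\<beta> e (Suc (Suc m)) (\<kappa> + Suc m \<cdot> ?\<beta>) f"
    using lead by (auto simp: lead_at_def)
  define y where "y = R - Q"
  have y: "degree y < degree R" "vge ?\<beta> y"
    using monic_diff_degree [OF dR(1) d(1) R(2) d(2)] R(2,3) vge_diff [of ?\<beta> R Q]
    by (auto simp: y_def vge_def less_imp_le)
  have Qy: "Q = R - y" by (simp add: y_def)
  note re = re_expansion_coeffs [OF R(1) Q(2) less_imp_le [OF Q(3)] y Qy filt]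
  have "vge (\<kappa> + e) (?c' (Suc m) - ?c (Suc m))" using re(2) by (simp add: algebra_simps)
  then have "vge (\<kappa> + e) (?c (Suc m) - ?c' (Suc m))" by (metis minus_diff_eq vge_minus)
  then have "vgt (u (?c (Suc m))) (?c (Suc m) - ?c' (Suc m))"
    using Q(3) D(2) unfolding vge_def vgt_def by (metis less_add_same_cancel1 order_less_le_trans)
  note D' = val_close [OF D(1) this]
  have big: "\<kappa> + Suc m \<cdot> ?\<beta>' + e \<le> k \<cdot> ?\<beta>' + u (?c' k)" if k: "Suc m < k" "?c' k \<noteq> 0" for k
  proof -
    have "\<kappa> + Suc m \<cdot> ?\<beta> + e \<le> k \<cdot> ?\<beta> + u (?c' k)"
      using re(1) [OF k(1)] k(2) by (simp add: vge_def diff_le_eq ac_simps)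
    moreover have "Suc m \<cdot> (?\<beta>' - ?\<beta>) \<le> k \<cdot> (?\<beta>' - ?\<beta>)"
      using k(1) R(3) by (intro nat_scale_mono_left) auto
    ultimately show ?thesis
      using add_mono [of "\<kappa> + Suc m \<cdot> ?\<beta> + e" "k \<cdot> ?\<beta> + u (?c' k)"]
      by (fastforce simp: nat_scale_diff algebra_simps)
  qed
  have "\<delta> = Suc m"
  proof (rule ccontr)
    assume "\<delta> \<noteq> Suc m"
    with lead'(2) have "Suc m < \<delta>" by simp
    then have "\<kappa> + Suc m \<cdot> ?\<beta>' + e \<le> \<delta> \<cdot> ?\<beta>' + \<kappa>'"
      using big lead'(1) by (auto simp: lead_at_def)
    also have "\<dots> = \<kappa>' + \<delta> \<cdot> ?\<beta>'" by (rule add.commute)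
    also have "\<dots> \<le> Suc m \<cdot> ?\<beta>' + \<kappa>" using lead_at_least(1) [OF lead'(1) D'(1)] D'(2) D(2) by simp
    finally have "e \<le> 0" by (simp add: algebra_simps)
    then show False using Q(3) by simp
  qed
  with lead'(1) D' D have "filt R ?\<beta>' e' (Suc (Suc m)) (\<kappa> + Suc m \<cdot> ?\<beta>') f" by (auto simp: lead_at_def)
  then have "filt R ?\<beta>' e (Suc (Suc m)) (\<kappa> + Suc m \<cdot> ?\<beta>') f"
    unfolding filt_def using big by (auto simp: vge_def diff_le_eq ac_simps Suc_le_eq)
  then show ?thesis using D' D by (simp add: lead_at_def)
qed

text \<open>Suppose that the values of the monic polynomials of the degree of \<open>P\<close> have no maximum. Choose
  one at which the last dominant index of \<open>f\<close> is minimal. From there on the leading coefficient, the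
  index and the precision \<open>e\<close> no longer change, and every Newton step raises the truncated value by at
  least \<open>e\<close>. As the rank is one, it eventually passes any given bound.\<close>

lemma plateau_truncation:
  assumes P: "key P \<tau>0" "hull_below P"
    and nomax: "\<And>Q. lead_coeff Q = 1 \<Longrightarrow> degree Q = degree P \<Longrightarrow>
                  \<exists>R. lead_coeff R = 1 \<and> degree R = degree P \<and> u Q < u R"
    and f: "f \<noteq> 0" "\<beta> \<in> divisible_hull" "\<beta> \<le> u f"
  obtains Q where "lead_coeff Q = 1" "degree Q = degree P" "u P < u Q" "\<beta> \<le> truncation v Q f"
proof -
  define \<tau> where "\<tau> = u P"
  define M where "M Q \<longleftrightarrow> lead_coeff Q = 1 \<and> degree Q = degree P \<and> \<tau> < u Q" for Q
  have Mkey: "key Q \<tau>" if "M Q" for Q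
    using plateau_key [OF P(1)] that unfolding M_def \<tau>_def by blast
  have Mhull: "u Q \<in> divisible_hull" if Q: "key Q \<tau>'" "degree Q = degree P" for Q \<tau>'
  proof -
    note d = keyD [OF that(1)]
    obtain R where R: "lead_coeff R = 1" "degree R = degree Q" "u Q < u R"
      using nomax [OF d(1) Q(2)] Q(2) by auto
    have "R \<noteq> 0" using R(1) by auto
    moreover have "unstable Q R" using same_degree_next(3) [OF that(1) R] R(3) by simp
    ultimately show ?thesis using hull_key [OF d(2)] P(2) that(2) by (simp add: hull_below_def)
  qed
  define ok where "ok Q e \<delta> \<kappa> \<longleftrightarrow> M Q \<and> 0 < e \<and> \<tau> + e \<le> u Q \<and> lead_at Q (u Q) e \<delta> \<kappa> f" for Q e \<delta> \<kappa>
  have ok_exists: "\<exists>e \<delta> \<kappa>. ok Q e \<delta> \<kappa> \<and> e \<in> divisible_hull \<and> \<kappa> \<in> divisible_hull" if "M Q" for Q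
  proof -
    note d = keyD [OF Mkey [OF that]]
    have chull: "u (adic_coeff Q f k) \<in> divisible_hull" if "adic_coeff Q f k \<noteq> 0" for k
      using P(2) that degree_adic_coeff [OF d(2), of f k] \<open>M Q\<close> by (simp add: hull_below_def M_def)
    have uQ: "u Q \<in> divisible_hull" "\<tau> \<in> divisible_hull"
      using Mhull [OF Mkey [OF that]] Mhull [OF P(1)] that by (auto simp: M_def \<tau>_def)
    have "0 < u Q - \<tau>" using that by (simp add: M_def)
    then obtain e \<delta> \<kappa> where lead: "lead_at Q (u Q) e \<delta> \<kappa> f" "0 < e" "e \<le> u Q - \<tau>"
      "e = u Q - \<tau> \<or> (\<exists>k l. adic_coeff Q f k \<noteq> 0 \<and> adic_coeff Q f l \<noteq> 0 \<and>
        e = (k \<cdot> u Q + u (adic_coeff Q f k)) - (l \<cdot> u Q + u (adic_coeff Q f l)))"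
      using lead_at_exists [OF d(2) f(1)] by metis
    have "e \<in> divisible_hull" using lead(4) uQ chull by (auto intro!: hull_diff hull_add hull_scale)
    moreover have "\<kappa> \<in> divisible_hull" using lead(1) chull by (auto simp: lead_at_def)
    moreover have "\<tau> + e \<le> u Q" using lead(3) by (simp add: le_diff_eq add.commute)
    ultimately show ?thesis using lead that by (auto simp: ok_def)
  qed
  obtain Q0 where Q0: "M Q0"
    using nomax [of P] keyD [OF P(1)] by (auto simp: M_def \<tau>_def)
  let ?S = "\<lambda>\<delta>. \<exists>Q e \<kappa>. ok Q e \<delta> \<kappa> \<and> e \<in> divisible_hull \<and> \<kappa> \<in> divisible_hull"
  define \<delta> where "\<delta> = (LEAST \<delta>. ?S \<delta>)"
  have "\<exists>\<delta>. ?S \<delta>" using ok_exists [OF Q0] by blast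
  then have "?S \<delta>" unfolding \<delta>_def by (rule LeastI_ex)
  then obtain Q e \<kappa> where start: "ok Q e \<delta> \<kappa>" "e \<in> divisible_hull" "\<kappa> \<in> divisible_hull" by blast
  then have MQ: "M Q" and e: "0 < e" by (auto simp: ok_def)
  have min: "\<delta> \<le> \<delta>'" if "ok Q' e' \<delta>' \<kappa>'" "e' \<in> divisible_hull" "\<kappa>' \<in> divisible_hull" for Q' e' \<delta>' \<kappa>'
    unfolding \<delta>_def using that by (intro Least_le) blast
  show thesis
  proof (cases \<delta>)
    case 0
    then have lead: "lead_at Q (u Q) e 0 \<kappa> f" using start by (simp add: ok_def)
    have dQ: "0 < degree Q" using keyD [OF Mkey [OF MQ]] by simp
    have "truncation v Q f = u f"
      using truncation_lead_at [OF lead dQ] lead_at_0 [OF lead dQ e] by simp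
    then show thesis using that MQ f by (auto simp: M_def \<tau>_def)
  next
    case (Suc m)
    have keep: "ok R e (Suc m) \<kappa>" if ok: "ok Q' e (Suc m) \<kappa>" and R: "M R" "u Q' < u R" for Q' R
    proof -
      obtain e' \<delta>' \<kappa>' where R': "ok R e' \<delta>' \<kappa>'" "e' \<in> divisible_hull" "\<kappa>' \<in> divisible_hull"
        using ok_exists [OF R(1)] by blast
      have "\<tau> + e \<le> u R" using ok R(2) by (auto simp: ok_def)
      moreover have "lead_at R (u R) e (Suc m) \<kappa> f"
        using lead_at_same_degree [of Q' \<tau> e m \<kappa> f R e' \<delta>' \<kappa>'] ok R R' Mkey min [OF R'] Suc
        by (auto simp: ok_def M_def)
      ultimately show ?thesis using ok R by (auto simp: ok_def)
    qed
    have step: "\<exists>R. ok R e (Suc m) \<kappa> \<and> u Q' + e \<le> u R" if ok: "ok Q' e (Suc m) \<kappa>" for Q'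
    proof -
      have Q': "key Q' \<tau>" "M Q'" "\<tau> + e \<le> u Q'" "lead_at Q' (u Q') e (Suc m) \<kappa> f"
        using ok Mkey by (auto simp: ok_def)
      note d = keyD [OF Q'(1)]
      obtain z where z: "degree z < degree Q'"
        and approx: "\<And>R. key R \<tau> \<Longrightarrow> degree R = degree Q' \<Longrightarrow> u Q' < u R \<Longrightarrow>
          vge (\<kappa> + u R) (adic_coeff R f m) \<Longrightarrow> vge (min (u R) (u Q' + e)) (Q' + z)"
        using newton_step [OF Q'(1,3) e Q'(4)] by metis
      define R1 where "R1 = Q' + z"
      have "degree R1 = degree Q'" unfolding R1_def using z by (simp add: degree_add_eq_left)
      moreover have "lead_coeff R1 = 1"
        using lead_coeff_add_le [OF z] d(1) by (simp only: R1_def add.commute)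
      ultimately have R1: "lead_coeff R1 = 1" "degree R1 = degree P" "R1 \<noteq> 0"
        using Q'(2) by (auto simp: M_def)
      have bound: "min (u R) (u Q' + e) \<le> u R1" if R: "M R" "u Q' < u R" for R
      proof -
        have lead: "lead_at R (u R) e (Suc m) \<kappa> f" using keep [OF ok R] by (simp add: ok_def)
        have "vge (\<kappa> + u R) (adic_coeff R f m)"
        proof (cases "adic_coeff R f m = 0")
          case False
          from lead_at_least(1) [OF lead False] show ?thesis by (simp add: vge_def algebra_simps)
        qed simp
        then have "vge (min (u R) (u Q' + e)) R1"
          using approx [OF Mkey [OF R(1)]] R Q'(2) by (simp add: M_def R1_def)
        then show ?thesis using R1(3) by (simp add: vge_def)
      qed
      have better: "\<exists>R. M R \<and> u S < u R" if "lead_coeff S = 1" "degree S = degree P" "\<tau> < u S" for S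
        using nomax [OF that(1,2)] that(3) by (auto simp: M_def)
      obtain R where "M R" "u Q' < u R" using better [of Q'] Q'(2) unfolding M_def by blast
      then have "min (u R) (u Q' + e) \<le> u R1" "u Q' < min (u R) (u Q' + e)" using bound e by auto
      then have gt: "u Q' < u R1" by (rule order_less_le_trans [rotated])
      then have MR1: "M R1" using R1 Q'(2) by (auto simp: M_def)
      \<comment> \<open>The same \<open>R1\<close> is compared with an approximation better than itself, so that the minimum in
        the bound must be attained by \<open>u Q' + e\<close>.\<close>
      have "u Q' + e \<le> u R1"
      proof (rule ccontr)
        assume less: "\<not> ?thesis"
        obtain R where R: "M R" "u R1 < u R" using better [of R1] MR1 unfolding M_def by blast
        then have "min (u R) (u Q' + e) \<le> u R1" using bound gt by simp
        with R less show False by (simp add: min_def split: if_splits)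
      qed
      then show ?thesis using keep [OF ok MR1 gt] by blast
    qed
    have iter: "\<exists>R. ok R e (Suc m) \<kappa> \<and> u Q + n \<cdot> e \<le> u R" for n
    proof (induction n)
      case 0
      then show ?case using start Suc by auto
    next
      case (Suc n)
      then obtain R where R: "ok R e (Suc m) \<kappa>" "u Q + n \<cdot> e \<le> u R" by blast
      obtain R' where R': "ok R' e (Suc m) \<kappa>" "u R + e \<le> u R'" using step [OF R(1)] by blast
      have "u Q + Suc n \<cdot> e = (u Q + n \<cdot> e) + e" by (simp add: ac_simps)
      also have "\<dots> \<le> u R + e" using R(2) by simp
      also note R'(2)
      finally show ?case using R'(1) by blast
    qed
    have "\<beta> - (\<kappa> + Suc m \<cdot> u Q) \<in> divisible_hull"
      using f(2) start(3) Mhull [OF Mkey [OF MQ]] MQ by (intro hull_diff hull_add hull_scale) (auto simp: M_def)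
    then obtain n where n: "\<beta> - (\<kappa> + Suc m \<cdot> u Q) \<le> n \<cdot> e" using archimedean_hull start(2) e by blast
    obtain R where R: "ok R e (Suc m) \<kappa>" "u Q + n \<cdot> e \<le> u R" using iter by blast
    have "\<beta> \<le> \<kappa> + Suc m \<cdot> u Q + n \<cdot> e" using n by (simp add: diff_le_eq ac_simps)
    also have "\<dots> \<le> \<kappa> + Suc m \<cdot> u Q + Suc m \<cdot> n \<cdot> e"
      using nat_scale_mono_left [of 1 "Suc m" "n \<cdot> e"] nat_scale_nonneg [of e n] e by (intro add_left_mono) simp
    also have "\<dots> = \<kappa> + Suc m \<cdot> (u Q + n \<cdot> e)" by (simp only: nat_scale_plus add.assoc)
    also have "\<dots> \<le> \<kappa> + Suc m \<cdot> u R" by (intro add_left_mono nat_scale_mono R(2))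
    also have "\<dots> = truncation v R f"
      using truncation_lead_at [of R e "Suc m" \<kappa> f] R(1) keyD [OF Mkey [of R]] by (simp add: ok_def)
    finally show thesis using that R(1) by (auto simp: ok_def M_def \<tau>_def)
  qed
qed

end

section \<open>Generation by products of key polynomials\<close>

lemma group_closure_mono: "S \<subseteq> T \<Longrightarrow> group_closure S \<subseteq> group_closure T"
proof
  fix x assume "S \<subseteq> T" "x \<in> group_closure S"
  from this(2,1) show "x \<in> group_closure T"
    by (induction rule: group_closure.induct) (auto intro: group_closure.intros)
qed

lemma group_closure_sum:
  "(\<And>i. i \<in> A \<Longrightarrow> f i \<in> group_closure S) \<Longrightarrow> (\<Sum>i\<in>A. f i) \<in> group_closure S"
  by (induction A rule: infinite_finite_induct) (auto intro: group_closure_add)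

lemma group_closure_mult_image:
  fixes t :: "'a::comm_ring_1"
  assumes "s \<in> group_closure S"
  shows "s * t \<in> group_closure ((\<lambda>s. s * t) ` S)"
  using assms
  by (induction rule: group_closure.induct)
     (auto simp: left_diff_distrib intro: group_closure.intros)

context poly_valuation
begin

lemma key_products_mono:
  "A \<subseteq> B \<Longrightarrow> key_products v A Q \<gamma> \<subseteq> key_products v B Q \<gamma>"
  unfolding key_products_def by blast

lemma key_products_mult_power:
  assumes "p \<in> key_products v {1..<i} Q \<gamma>" "1 \<le> i"
  shows "p * Q i ^ j \<in> key_products v {1..i::nat} Q (\<gamma> + j \<cdot> u (Q i))"
proof -
  obtain a I g where p: "p = [:a:] * (\<Prod>k\<in>I. Q k ^ g k)" "a \<noteq> 0" "finite I" "I \<subseteq> {1..<i}"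
    "\<gamma> \<le> (\<Sum>k\<in>I. g k \<cdot> u (Q k)) + const_val v a"
    using assms(1) unfolding key_products_def by blast
  define g' where "g' = g(i := j)"
  have i: "i \<notin> I" using p(4) by auto
  have I: "(\<Prod>k\<in>I. Q k ^ g k) = (\<Prod>k\<in>I. Q k ^ g' k)"
    "(\<Sum>k\<in>I. g k \<cdot> u (Q k)) = (\<Sum>k\<in>I. g' k \<cdot> u (Q k))"
    using i by (auto simp: g'_def intro!: prod.cong sum.cong)
  have "p * Q i ^ j = [:a:] * (\<Prod>k\<in>insert i I. Q k ^ g' k)"
    unfolding p(1) I using i p(3) by (simp add: g'_def mult.commute)
  moreover have "\<gamma> + j \<cdot> u (Q i) \<le> (\<Sum>k\<in>insert i I. g' k \<cdot> u (Q k)) + const_val v a"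
    using add_right_mono [OF p(5), of "j \<cdot> u (Q i)"] i p(3) unfolding I
    by (simp add: g'_def algebra_simps)
  moreover have "finite (insert i I)" "insert i I \<subseteq> {1..i}" using p(3,4) assms(2) by auto
  ultimately show ?thesis using p(2) unfolding key_products_def by blast
qed

text \<open>Expanding successively with respect to \<open>Q i\<close>, \<open>Q (i - 1)\<close>, and so on down to \<open>Q 1\<close> loses no
  value, since the coefficients have smaller degree and are measured correctly by the previous
  truncation.\<close>

lemma generated_by_products:
  assumes Q1: "degree (Q 1) = 1" and deg: "\<And>i. 1 \<le> i \<Longrightarrow> i \<le> n \<Longrightarrow> 0 < degree (Q i)"
    and stable: "\<And>i c. 1 \<le> i \<Longrightarrow> Suc i \<le> n \<Longrightarrow> c \<noteq> 0 \<Longrightarrow> degree c < degree (Q (Suc i)) \<Longrightarrow>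
        truncation v (Q i) c = u c"
    and i: "1 \<le> i" "i \<le> n" and f: "f \<noteq> 0" "\<gamma> \<le> truncation v (Q i) f"
  shows "f \<in> group_closure (key_products v {1..i::nat} Q \<gamma>)"
  using i f
proof (induction i arbitrary: f \<gamma>)
  case (Suc i)
  let ?Q = "Q (Suc i)" and ?c = "adic_coeff (Q (Suc i)) f"
  have d: "0 < degree ?Q" using deg Suc.prems by simp
  have small: "c \<in> group_closure (key_products v {1..<Suc i} Q \<gamma>')"
    if "c \<noteq> 0" "degree c < degree ?Q" "\<gamma>' \<le> u c" for c \<gamma>'
  proof (cases "i = 0")
    case True
    then have "degree c = 0" using that(2) Q1 by simp
    then obtain a where a: "c = [:a:]" by (rule degree_eq_zeroE)
    then have "a \<noteq> 0" "\<gamma>' \<le> const_val v a" using that by (auto simp: const_val_def poly_val_def)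
    then have "c \<in> key_products v {1..<Suc i} Q \<gamma>'"
      unfolding key_products_def a
      by (intro CollectI exI [of _ a] exI [of _ "{}"] exI [of _ "\<lambda>_. 0"]) auto
    then show ?thesis by (intro group_closure.base) simp
  next
    case False
    then have "truncation v (Q i) c = u c" using stable [of i c] that Suc.prems by simp
    then show ?thesis using Suc.IH [of c \<gamma>'] False Suc.prems that
      by (simp add: atLeastLessThanSuc_atLeastAtMost)
  qed
  have "?c j * ?Q ^ j \<in> group_closure (key_products v {1..Suc i} Q \<gamma>)" for j
  proof (cases "?c j = 0")
    case False
    have "\<gamma> \<le> j \<cdot> u ?Q + u (?c j)" using Suc.prems truncation_le_term [OF d False] by (metis order_trans)
    then have "\<gamma> - j \<cdot> u ?Q \<le> u (?c j)" by (simp add: diff_le_eq add.commute)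
    then have "?c j \<in> group_closure (key_products v {1..<Suc i} Q (\<gamma> - j \<cdot> u ?Q))"
      using small False degree_adic_coeff [OF d] by blast
    then have "?c j * ?Q ^ j \<in> group_closure ((\<lambda>s. s * ?Q ^ j) ` key_products v {1..<Suc i} Q (\<gamma> - j \<cdot> u ?Q))"
      by (rule group_closure_mult_image)
    moreover have "(\<lambda>s. s * ?Q ^ j) ` key_products v {1..<Suc i} Q (\<gamma> - j \<cdot> u ?Q)
        \<subseteq> key_products v {1..Suc i} Q \<gamma>"
      using key_products_mult_power [of _ "Suc i" Q "\<gamma> - j \<cdot> u ?Q" j] by auto
    ultimately show ?thesis using group_closure_mono by blast
  qed simp
  then have "(\<Sum>j\<le>degree f. ?c j * ?Q ^ j) \<in> group_closure (key_products v {1..Suc i} Q \<gamma>)"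
    by (intro group_closure_sum)
  then show ?case using adic_expansion(1) [OF d, of f] by simp
qed simp

lemma val_prod_power:
  assumes "finite I" "\<And>i. i \<in> I \<Longrightarrow> Q i \<noteq> 0"
  shows "u (\<Prod>i\<in>I. Q i ^ g i) = (\<Sum>i\<in>I. g i \<cdot> u (Q i))"
  using assms by (induction I rule: finite_induct) (auto simp: val_mult val_power)

lemma key_products_vge:
  assumes "\<And>i. i \<in> \<Lambda> \<Longrightarrow> Q i \<noteq> 0" "f \<in> group_closure (key_products v \<Lambda> Q \<beta>)"
  shows "vge \<beta> f"
  using assms(2)
proof (induction rule: group_closure.induct)
  case (base p)
  show ?case
  proof (cases "p = 0")
    case False
    then obtain a I g where p: "p = [:a:] * (\<Prod>k\<in>I. Q k ^ g k)" "a \<noteq> 0" "finite I" "I \<subseteq> \<Lambda>"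
      "\<beta> \<le> (\<Sum>k\<in>I. g k \<cdot> u (Q k)) + const_val v a"
      using base unfolding key_products_def by blast
    have nz: "Q i \<noteq> 0" if "i \<in> I" for i using assms(1) p(4) that by blast
    have "u p = u [:a:] + (\<Sum>k\<in>I. g k \<cdot> u (Q k))"
      unfolding p(1) using p(2,3) nz by (simp add: val_mult val_prod_power del: mult_pCons_left)
    then show ?thesis using p(5) by (simp add: vge_def const_val_def poly_val_def add.commute)
  qed simp
qed (rule vge_diff)

end

section \<open>Construction of the sequence\<close>

context rank_one_char_0_valuation
begin

definition maximal :: "'k poly \<Rightarrow> bool" where
  "maximal S \<longleftrightarrow> lead_coeff S = 1 \<and> (\<forall>R. lead_coeff R = 1 \<longrightarrow> degree R = degree S \<longrightarrow> u R \<le> u S)"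

definition monic_values :: "nat \<Rightarrow> 'g set" where
  "monic_values d = u ` {R. lead_coeff R = 1 \<and> degree R = d}"

text \<open>Depending only on the degree, the sequence is the same for all members of a plateau.\<close>

definition cofinal_seq :: "nat \<Rightarrow> nat \<Rightarrow> 'g" where
  "cofinal_seq d = (SOME t. (\<forall>i. t i \<in> monic_values d) \<and> (\<forall>s\<in>monic_values d. \<exists>i. s < t i))"

text \<open>Without a maximum, every value \<open>v(R)\<close> in question is also the value of the difference of \<open>R\<close> and
  a better polynomial, which has smaller degree.\<close>

lemma cofinal_seq:
  assumes Q: "lead_coeff Q = 1" "0 < degree Q" "hull_below Q"
    and nomax: "\<not> (\<exists>S. maximal S \<and> degree S = degree Q)"
  shows "cofinal_seq (degree Q) i \<in> monic_values (degree Q)"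
    and "s \<in> monic_values (degree Q) \<Longrightarrow> \<exists>i. s < cofinal_seq (degree Q) i"
proof -
  let ?V = "monic_values (degree Q)"
  have larger: "\<exists>s'\<in>?V. s < s'" if s: "s \<in> ?V" for s
  proof -
    obtain R where R: "s = u R" "lead_coeff R = 1" "degree R = degree Q"
      using s by (auto simp: monic_values_def)
    then obtain R' where "lead_coeff R' = 1" "degree R' = degree Q" "u R < u R'"
      using nomax unfolding maximal_def by (metis not_le)
    then show ?thesis using R(1) unfolding monic_values_def by blast
  qed
  have "?V \<subseteq> divisible_hull"
  proof
    fix s assume s: "s \<in> ?V"
    then obtain R where R: "s = u R" "lead_coeff R = 1" "degree R = degree Q" by (auto simp: monic_values_def)
    from larger [OF s] obtain R' where R': "u R < u R'" "lead_coeff R' = 1" "degree R' = degree Q"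
      unfolding R(1) by (auto simp: monic_values_def)
    have R0: "R \<noteq> 0" using R(2) by auto
    have "vgt (u (- R)) (- R - (R' - R))" using R'(1) by (simp add: vgt_def)
    from val_close [OF _ this] R0 have z: "R' - R \<noteq> 0" "u (R' - R) = u R" by auto
    have "degree (R' - R) < degree Q" using monic_diff_degree [of R' R] R R' Q(2) by simp
    then have "u (R' - R) \<in> divisible_hull" using Q(3) z(1) unfolding hull_below_def by blast
    then show "s \<in> divisible_hull" using z(2) R(1) by simp
  qed
  moreover have "?V \<noteq> {}" using Q(1) by (auto simp: monic_values_def)
  ultimately have "\<exists>t. (\<forall>i. t i \<in> ?V) \<and> (\<forall>s\<in>?V. \<exists>i::nat. s < t i)"
    using larger by (rule countable_cofinal)
  then have "(\<forall>i. cofinal_seq (degree Q) i \<in> ?V) \<and> (\<forall>s\<in>?V. \<exists>i. s < cofinal_seq (degree Q) i)"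
    unfolding cofinal_seq_def by (rule someI_ex)
  then show "cofinal_seq (degree Q) i \<in> ?V" "s \<in> ?V \<Longrightarrow> \<exists>i. s < cofinal_seq (degree Q) i" by auto
qed

text \<open>If the degree does not grow, the successor has maximal value, or, when there is no maximum, it
  passes the first \<open>n + 1\<close> members of the cofinal sequence. Letting the bound depend on \<open>n\<close> makes the
  values cofinal wherever the plateau begins.\<close>

definition step :: "nat \<Rightarrow> 'k poly \<Rightarrow> 'k poly \<Rightarrow> bool" where
  "step n Q R \<longleftrightarrow> least_degree_monic (unstable Q) R \<and> homogeneous_expansion v Q R \<and>
     (degree R = degree Q \<longrightarrow> maximal R \<or>
        (\<not> (\<exists>S. maximal S \<and> degree S = degree Q) \<and> (\<forall>j\<le>n. cofinal_seq (degree Q) j \<le> u R)))"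

definition terminal :: "'k poly \<Rightarrow> bool" where
  "terminal Q \<longleftrightarrow> (\<forall>f. f \<noteq> 0 \<longrightarrow> truncation v Q f = u f)"

definition good :: "'k poly \<Rightarrow> bool" where
  "good Q \<longleftrightarrow> (\<exists>\<tau>. key Q \<tau>) \<and> hull_below Q"

lemma step_good: "good Q \<Longrightarrow> step n Q R \<Longrightarrow> good R"
  unfolding good_def step_def using key_next hull_next by blast

lemma step_exists:
  assumes "good Q" "\<not> terminal Q"
  shows "\<exists>R. step n Q R"
proof -
  obtain \<tau> where Q: "key Q \<tau>" "hull_below Q" using assms(1) by (auto simp: good_def)
  note d = keyD [OF Q(1)]
  obtain f where f: "f \<noteq> 0" "truncation v Q f \<noteq> u f" using assms(2) by (auto simp: terminal_def)
  then have "unstable Q f" using truncation_le [OF d(2) f(1)] by simp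
  then obtain R where R: "least_degree_monic (unstable Q) R" "homogeneous_expansion v Q R"
    using next_exists [OF Q(1) f(1)] by blast
  have R1: "lead_coeff R = 1" using R by (simp add: least_degree_monic_def)
  show ?thesis
  proof (cases "degree R = degree Q")
    case False
    then show ?thesis using R unfolding step_def by blast
  next
    case True
    note gt = same_degree_next_greater [OF Q(1) R(1) True]
    show ?thesis
    proof (cases "\<exists>S. maximal S \<and> degree S = degree Q")
      case True
      then obtain S where S: "maximal S" "degree S = degree Q" by blast
      then have "u R \<le> u S" using R1 \<open>degree R = degree Q\<close> unfolding maximal_def by metis
      with gt have "u Q < u S" by simp
      moreover have "lead_coeff S = 1" using S(1) by (simp add: maximal_def)
      ultimately show ?thesis using same_degree_next [OF Q(1)] S unfolding step_def by blast
    next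
      case False
      define F where "F = insert (u Q) (cofinal_seq (degree Q) ` {..n})"
      have "F \<subseteq> monic_values (degree Q)"
        using cofinal_seq(1) [OF d(1,2) Q(2) False] d(1) by (auto simp: F_def monic_values_def)
      moreover have F: "finite F" "F \<noteq> {}" by (auto simp: F_def)
      ultimately have "Max F \<in> monic_values (degree Q)" using Max_in by blast
      then obtain S where S: "Max F = u S" "lead_coeff S = 1" "degree S = degree Q"
        by (auto simp: monic_values_def)
      with False obtain S' where S': "lead_coeff S' = 1" "degree S' = degree Q" "u S < u S'"
        unfolding maximal_def by (metis not_le)
      have le: "x < u S'" if "x \<in> F" for x using Max_ge [OF F(1) that] S(1) S'(3) by simp
      have "u Q < u S'" using le by (simp add: F_def)
      moreover have "\<forall>j\<le>n. cofinal_seq (degree Q) j \<le> u S'"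
        using le by (auto simp: F_def intro: less_imp_le)
      ultimately show ?thesis
        using same_degree_next [OF Q(1) S'(1,2)] False unfolding step_def by blast
    qed
  qed
qed

lemma sequence_exists:
  assumes x: "u var_x > 0"
  obtains s where "s 0 = var_x" "\<And>n. good (s n)" "\<And>n. \<not> terminal (s n) \<Longrightarrow> step n (s n) (s (Suc n))"
proof -
  let ?P = "\<lambda>n Q. good Q \<and> (n = 0 \<longrightarrow> Q = var_x)"
  let ?R = "\<lambda>n Q R. \<not> terminal Q \<longrightarrow> step n Q R"
  have "\<exists>s. \<forall>n. ?P n (s n) \<and> ?R n (s n) (s (Suc n))"
  proof (rule dependent_nat_choice)
    have "key var_x 0" using x by (intro key_linear) auto
    moreover have "u a \<in> divisible_hull" if "a \<noteq> 0" "degree a = 0" for a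
      using that G1_hull G1I by (metis degree_eq_zeroE pCons_0_0)
    then have "hull_below var_x" by (simp add: hull_below_def)
    ultimately show "\<exists>Q. ?P 0 Q" by (auto simp: good_def)
  next
    fix Q :: "'k poly" and n :: nat assume Q: "?P n Q"
    show "\<exists>R. ?P (Suc n) R \<and> ?R n Q R"
    proof (cases "terminal Q")
      case True
      then show ?thesis using Q by auto
    next
      case False
      then obtain R where "step n Q R" using step_exists Q by blast
      then show ?thesis using step_good Q by blast
    qed
  qed
  then show thesis using that by blast
qed

text \<open>If the degrees stay bounded, they are eventually constant, say equal to \<open>d\<close>. Then the values of
  the monic polynomials of degree \<open>d\<close> have no maximum, and the sequence is cofinal among them.\<close>

lemma infinite_sequence_covers:
  assumes good: "\<And>n. good (s n)" and step: "\<And>n. step n (s n) (s (Suc n))"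
    and f: "f \<noteq> 0" "\<beta> \<in> G1" "\<beta> \<le> u f"
  shows "\<exists>n. \<beta> \<le> truncation v (s n) f"
proof (cases "\<exists>n. degree f < degree (s (Suc n))")
  case True
  then obtain n where n: "degree f < degree (s (Suc n))" by blast
  obtain \<tau> where "key (s n) \<tau>" using good by (auto simp: good_def)
  then have "truncation v (s n) f = u f"
    using least_stable f(1) n step [of n] unfolding step_def by blast
  then show ?thesis using f(3) by metis
next
  case False
  have key: "\<exists>\<tau>. key (s n) \<tau>" and hull: "hull_below (s n)" for n using good by (auto simp: good_def)
  have least: "least_degree_monic (unstable (s n)) (s (Suc n))" for n using step by (simp add: step_def)
  have mono: "degree (s n) \<le> degree (s (Suc n))" for n using key key_next(2) least by blast
  have "degree (s n) \<le> degree f + degree (s 0)" for n using False by (cases n) (auto simp: not_less trans_le_add1)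
  then obtain n0 where n0: "\<And>n. degree (s n) \<le> degree (s n0)"
    using ex_has_greatest_nat [of "\<lambda>_. True" 0 "\<lambda>n. degree (s n)" "Suc (degree f + degree (s 0))"]
    by (auto simp: le_imp_less_Suc)
  have const: "degree (s n) = degree (s n0)" if "n0 \<le> n" for n
    using lift_Suc_mono_le [of "\<lambda>n. degree (s n)", OF mono that] n0 [of n] by simp
  let ?d = "degree (s n0)"
  have greater: "u (s n) < u (s (Suc n))" if "n0 \<le> n" for n
    using same_degree_next_greater [OF _ least] key const that by (metis le_Suc_eq)
  have monic: "lead_coeff (s n) = 1" "0 < degree (s n)" for n using key keyD by blast+
  have "\<not> maximal (s (Suc n))" if "n0 \<le> n" for n
    using greater [of "Suc n"] const [of "Suc n"] const [of "Suc (Suc n)"] monic that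
    unfolding maximal_def by (metis le_SucI not_le)
  then have plateau: "\<not> (\<exists>S. maximal S \<and> degree S = ?d) \<and> (\<forall>j\<le>n. cofinal_seq ?d j \<le> u (s (Suc n)))"
    if "n0 \<le> n" for n
    using step [of n] const [of n] const [of "Suc n"] that unfolding step_def by (metis le_SucI)
  then have nomax: "\<not> (\<exists>S. maximal S \<and> degree S = ?d)" by blast
  obtain \<tau> where P: "key (s n0) \<tau>" using key by blast
  have "\<exists>R. lead_coeff R = 1 \<and> degree R = ?d \<and> u Q < u R" if "lead_coeff Q = 1" "degree Q = ?d" for Q
    using nomax that unfolding maximal_def by (metis not_le)
  then obtain Q where Q: "lead_coeff Q = 1" "degree Q = ?d" "\<beta> \<le> truncation v Q f"
    using plateau_truncation [OF P hull _ f(1) G1_hull [OF f(2)] f(3)] by metis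
  have "u Q \<in> monic_values ?d" using Q(1,2) unfolding monic_values_def by blast
  then obtain j where "u Q < cofinal_seq ?d j" using cofinal_seq(2) [OF monic hull nomax] by blast
  also have "\<dots> \<le> u (s (Suc (max n0 j)))" using plateau [of "max n0 j"] by simp
  finally have "u Q \<le> u (s (Suc (max n0 j)))" by simp
  moreover have "degree Q = degree (s (Suc (max n0 j)))" using Q const [of "Suc (max n0 j)"] by simp
  ultimately have "truncation v Q f \<le> truncation v (s (Suc (max n0 j))) f"
    using truncation_same_degree_mono Q(1) f(1) key by blast
  then show ?thesis using Q(3) order_trans by blast
qed

lemma nat_interval_next:
  assumes "\<Lambda> = {1..N} \<or> \<Lambda> = {1::nat..}" "is_next \<Lambda> i j"
  shows "j = Suc i" "1 \<le> i" "i \<in> \<Lambda>" "j \<in> \<Lambda>"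
proof -
  have ij: "i \<in> \<Lambda>" "j \<in> \<Lambda>" "i < j" "\<not> (\<exists>k\<in>\<Lambda>. i < k \<and> k < j)" using assms(2) by (auto simp: is_next_def)
  have "Suc i \<in> \<Lambda>" using assms(1) ij(1-3) by auto
  then show "j = Suc i" using ij(3,4) by (metis Suc_lessI lessI)
  show "1 \<le> i" "i \<in> \<Lambda>" "j \<in> \<Lambda>" using ij assms(1) by auto
qed

lemma nat_interval_no_limit:
  assumes "\<Lambda> = {1..N} \<or> \<Lambda> = {1::nat..}"
  shows "\<not> is_limit \<Lambda> j"
proof
  assume "is_limit \<Lambda> j"
  then have j: "j \<in> \<Lambda>" "\<not> is_first \<Lambda> j" "\<And>i. \<not> is_next \<Lambda> i j" by (auto simp: is_limit_def)
  show False
  proof (cases "j = 1")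
    case True
    then show False using j(1,2) assms by (auto simp: is_first_def)
  next
    case False
    then have "is_next \<Lambda> (j - 1) j" using j(1) assms by (auto simp: is_next_def)
    then show False using j(3) by blast
  qed
qed

text \<open>What the construction has to provide: recursion steps at successive indices, and truncations that
  together reach every bound in the value group of \<open>K\<close>.\<close>

lemma one_complete:
  assumes \<Lambda>: "\<Lambda> = {1..N} \<and> 1 \<le> N \<or> \<Lambda> = {1::nat..}"
    and Q1: "Q 1 = var_x" and good: "\<And>i. i \<in> \<Lambda> \<Longrightarrow> good (Q i)"
    and step: "\<And>i. i \<in> \<Lambda> \<Longrightarrow> Suc i \<in> \<Lambda> \<Longrightarrow>
        least_degree_monic (unstable (Q i)) (Q (Suc i)) \<and> homogeneous_expansion v (Q i) (Q (Suc i))"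
    and cover: "\<And>f \<beta>. f \<noteq> 0 \<Longrightarrow> \<beta> \<in> G1 \<Longrightarrow> \<beta> \<le> u f \<Longrightarrow> \<exists>i\<in>\<Lambda>. \<beta> \<le> truncation v (Q i) f"
  shows "one_complete_key_polynomials v \<Lambda> Q"
  unfolding one_complete_key_polynomials_def key_polynomials_def
proof (intro conjI allI impI ballI)
  have \<Lambda>': "\<Lambda> = {1..N} \<or> \<Lambda> = {1..}" using \<Lambda> by blast
  have key: "\<exists>\<tau>. key (Q i) \<tau>" if "i \<in> \<Lambda>" for i using good [OF that] by (simp add: good_def)
  have nonzero: "Q i \<noteq> 0" if "i \<in> \<Lambda>" for i using key [OF that] keyD(4) by blast
  show "\<Lambda> \<noteq> {}" using \<Lambda> by auto
  show "Q i = var_x" if "is_first \<Lambda> i" for i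
  proof -
    have "1 \<in> \<Lambda>" using \<Lambda> by auto
    then have "i \<le> 1" using that by (simp add: is_first_def)
    moreover have "1 \<le> i" using that \<Lambda> by (auto simp: is_first_def)
    ultimately have "i = 1" by simp
    then show ?thesis using Q1 by simp
  qed
  show "least_degree_monic (unstable (Q i)) (Q j)" "homogeneous_expansion v (Q i) (Q j)"
    if "is_next \<Lambda> i j" for i j
    using nat_interval_next [OF \<Lambda>' that] step by auto
  show "least_degree_monic (\<lambda>R. \<forall>i\<in>\<Lambda>. i < j \<longrightarrow> unstable (Q i) R) (Q j)" if "is_limit \<Lambda> j" for j
    using nat_interval_no_limit [OF \<Lambda>'] that by blast
  show "group_closure (key_products v \<Lambda> Q \<beta>) = {f. f \<noteq> 0 \<and> \<beta> \<le> u f} \<union> {0}"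
    if \<beta>: "\<beta> \<in> value_group (const_val v)" for \<beta>
  proof (intro equalityI subsetI)
    fix f assume "f \<in> group_closure (key_products v \<Lambda> Q \<beta>)"
    with nonzero have "vge \<beta> f" by (rule key_products_vge)
    then show "f \<in> {f. f \<noteq> 0 \<and> \<beta> \<le> u f} \<union> {0}" by (auto simp: vge_def)
  next
    fix f assume f: "f \<in> {f. f \<noteq> 0 \<and> \<beta> \<le> u f} \<union> {0}"
    show "f \<in> group_closure (key_products v \<Lambda> Q \<beta>)"
    proof (cases "f = 0")
      case False
      then obtain i where i: "i \<in> \<Lambda>" "\<beta> \<le> truncation v (Q i) f"
        using cover f \<beta> by (auto simp: G1_def)
      have sub: "{1..i} \<subseteq> \<Lambda>" "1 \<le> i" using i(1) \<Lambda> by auto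
      have "f \<in> group_closure (key_products v {1..i} Q \<beta>)"
      proof (rule generated_by_products [where n = i])
        show "degree (Q 1) = 1" using Q1 by simp
        show "0 < degree (Q k)" if "1 \<le> k" "k \<le> i" for k
        proof -
          have "k \<in> \<Lambda>" using sub(1) that by auto
          then show ?thesis using key [of k] keyD(2) by blast
        qed
        show "truncation v (Q k) c = u c"
          if c: "1 \<le> k" "Suc k \<le> i" "c \<noteq> 0" "degree c < degree (Q (Suc k))" for k c
        proof -
          have k: "k \<in> \<Lambda>" "Suc k \<in> \<Lambda>" using sub(1) c(1,2) by auto
          obtain \<tau> where "key (Q k) \<tau>" using key [OF k(1)] by blast
          then show ?thesis using least_stable step [OF k] c(3,4) by blast
        qed
      qed (use False i sub in auto)
      then show ?thesis using group_closure_mono [OF key_products_mono [OF sub(1)]] by blast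
    qed simp
  qed
qed

end

theorem mainTheorem9:
  fixes v :: "'k::field poly fract \<Rightarrow> 'g::linordered_ab_group_add"
  assumes "is_valuation v"
    and "poly_val v var_x > 0"
    and "has_rank (const_val v) 1"
    and "has_char_0 (residue_field (const_val v))"
  shows "\<exists>(\<Lambda> :: nat set) Q.
           one_complete_key_polynomials v \<Lambda> Q \<and>
           ((\<exists>N. \<Lambda> = {1..N}) \<or> \<Lambda> = {1..}) \<and>
           (\<forall>i\<in>\<Lambda>. \<not> is_limit \<Lambda> i)"
proof -
  interpret rank_one_char_0_valuation v
    using assms by unfold_locales
  obtain s where s: "s 0 = var_x" "\<And>n. good (s n)" "\<And>n. \<not> terminal (s n) \<Longrightarrow> step n (s n) (s (Suc n))"
    using sequence_exists [OF assms(2)] by blast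
  define Q where "Q i = s (i - 1)" for i
  show ?thesis
  proof (cases "\<exists>n. terminal (s n)")
    case True
    define N where "N = (LEAST n. terminal (s n))"
    have N: "terminal (s N)" unfolding N_def using True by (rule LeastI_ex)
    have before: "step n (s n) (s (Suc n))" if "n < N" for n
      using s(3) not_less_Least that by (auto simp: N_def)
    have "one_complete_key_polynomials v {1..Suc N} Q"
    proof (rule one_complete)
      fix f \<beta> assume "f \<noteq> 0" "\<beta> \<le> u f"
      then show "\<exists>i\<in>{1..Suc N}. \<beta> \<le> truncation v (Q i) f"
        using N by (intro bexI [of _ "Suc N"]) (auto simp: Q_def terminal_def)
    next
      fix i assume "i \<in> {1..Suc N}" "Suc i \<in> {1..Suc N}"
      then show "least_degree_monic (unstable (Q i)) (Q (Suc i)) \<and> homogeneous_expansion v (Q i) (Q (Suc i))"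
        using before [of "i - 1"] by (auto simp: Q_def step_def)
    qed (use s in \<open>auto simp: Q_def\<close>)
    then show ?thesis using nat_interval_no_limit by blast
  next
    case False
    then have always: "step n (s n) (s (Suc n))" for n using s(3) by blast
    have "one_complete_key_polynomials v {1..} Q"
    proof (rule one_complete)
      fix f \<beta> assume "f \<noteq> 0" "\<beta> \<in> G1" "\<beta> \<le> u f"
      then obtain n where "\<beta> \<le> truncation v (s n) f"
        using infinite_sequence_covers [OF s(2) always] by blast
      then show "\<exists>i\<in>{1..}. \<beta> \<le> truncation v (Q i) f"
        by (intro bexI [of _ "Suc n"]) (auto simp: Q_def)
    next
      fix i :: nat assume "i \<in> {1..}" "Suc i \<in> {1..}"
      then show "least_degree_monic (unstable (Q i)) (Q (Suc i)) \<and> homogeneous_expansion v (Q i) (Q (Suc i))"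
        using always [of "i - 1"] by (auto simp: Q_def step_def)
    qed (use s in \<open>auto simp: Q_def\<close>)
    then show ?thesis using nat_interval_no_limit by blast
  qed
qed

end
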